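(* Let $r$ be a positive integer, $\mathbf{k}_1,\dots,\mathbf{k}_r$ indices, and $\mathbf{t}=(t_1,\dots,t_r)$ a tuple of indeterminates. Let $\mathbf{k}=(\mathbf{k}_1,\dots,\mathbf{k}_r)$ and $\mathbf{k}'=(\mathbf{k}_1^{\vee},\dots,\mathbf{k}_r^{\vee})$ be the concatenated indices, and put $l_i=\mathrm{dep}(\mathbf{k}_i)$ and $l'_i=\mathrm{dep}(\mathbf{k}_i^{\vee})$ for $i=1,\dots,r$. Then $$\mathcal{L}_{\widehat{\mathcal{A}},\mathbf{k}}^{\star}(\{1\}^{l_1-1},t_1,\dots,\{1\}^{l_r-1},t_r)=\mathcal{L}_{\widehat{\mathcal{A}},\mathbf{k}'}^{\star}(\{1\}^{l'_1-1},1-t_1,\dots,\{1\}^{l'_r-1},1-t_r)$$ in the ring $\widehat{\mathcal{A}}_{\mathbb{Z}[\mathbf{t}]}$.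
   Context: An index is a tuple $\mathbf{k}=(k_1,\dots,k_m)$ of positive integers ($m\ge1$); its depth is $\mathrm{dep}(\mathbf{k})=m$. $\{a\}^i$ denotes $a$ repeated $i$ times, and tuples are concatenated in the obvious way. Hoffman dual: let $W$ be the free monoid on $\{0,1\}$. To an index $\mathbf{k}$ associate the word $w(\mathbf{k})=\underbrace{0\cdots0}_{k_1-1}1\underbrace{0\cdots0}_{k_2-1}1\cdots1\underbrace{0\cdots0}_{k_m-1}1$; $w$ is a bijection from the set of all indices onto $W1$ (words ending in $1$). Let $\tau\colon W\to W$ be the monoid homomorphism with $\tau(0)=1$, $\tau(1)=0$. The Hoffman dual $\mathbf{k}^{\vee}$ is the index determined by $w(\mathbf{k}^{\vee})=\tau(w(\mathbf{k})1^{-1})1$ (delete the last letter $1$, exchange $0$ and $1$, append $1$). Rings: for a tuple $\mathbf{t}$ of indeterminates and a positive integer $n$, $\mathcal{A}_{n,\mathbb{Z}[\mathbf{t}]}=\left(\prod_p\mathbb{Z}[\mathbf{t}]/p^n\mathbb{Z}[\mathbf{t}]\right)/\left(\bigoplus_p\mathbb{Z}[\mathbf{t}]/p^n\mathbb{Z}[\mathbf{t}]\right)$ ($p$ running over all primes), with the discrete topology, and $\widehat{\mathcal{A}}_{\mathbb{Z}[\mathbf{t}]}=\varprojlim_n\mathcal{A}_{n,\mathbb{Z}[\mathbf{t}]}$ with the projective limit topology; these are $\mathbb{Q}$-algebras. There is a natural surjection $\pi\colon\prod_p\widehat{\mathbb{Z}[\mathbf{t}]}_p\to\widehat{\mathcal{A}}_{\mathbb{Z}[\mathbf{t}]}$,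 where $\widehat{\mathbb{Z}[\mathbf{t}]}_p=\varprojlim_n\mathbb{Z}[\mathbf{t}]/p^n\mathbb{Z}[\mathbf{t}]$, induced by reduction mod $p^n$ in each component; since components at finitely many primes do not matter, $\pi$ may be applied to families defined for all but finitely many $p$. Put $\boldsymbol{p}=\pi((p)_p)$. The topology of $\widehat{\mathcal{A}}_{\mathbb{Z}[\mathbf{t}]}$ is the $\boldsymbol{p}$-adic one and it is complete; infinite sums are taken in this topology. Finite shuffle star-multiple polylogarithms: for an index $\mathbf{k}=(k_1,\dots,k_m)$ and $\mathbf{s}=(s_1,\dots,s_m)$, $$\pounds_{n,\mathbf{k}}^{\mathrm{sh},\star}(\mathbf{s})=\sum_{n\ge n_1\ge\cdots\ge n_m\ge1}\frac{s_1^{n_1-n_2}\cdots s_{m-1}^{n_{m-1}-n_m}s_m^{n_m}}{n_1^{k_1}\cdots n_m^{k_m}},\qquad \pounds_{\widehat{\mathcal{A}},\mathbf{k}}^{\mathrm{sh},\star}(\mathbf{s})=\pi\left((\pounds_{p-1,\mathbf{k}}^{\mathrm{sh},\star}(\mathbf{s}))_p\right).$$ With $\mathbf{s}_1=(s_1,\dots,s_{m-1},1)$, define $$\mathcal{L}_{\widehat{\mathcal{A}},\mathbf{k}}^{\star}(\mathbf{s})=\sum_{i=0}^{\infty}\left(\pounds_{\widehat{\mathcal{A}},(\{1\}^i,\mathbf{k})}^{\mathrm{sh},\star}(\{1\}^i,\mathbf{s})-\frac12\pounds_{\widehat{\mathcal{A}},(\{1\}^i,\mathbf{k})}^{\mathrm{sh},\star}(\{1\}^i,\mathbf{s}_1)\right)\boldsymbol{p}^i.$$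 The arguments $s_j$ may be any polynomials in $\mathbb{Z}[\mathbf{t}]$ (such as $1$, $t_i$, $1-t_i$), substituted in every $p$-component. *)

theory Defs
  imports
    "HOL-Algebra.QuotRing"
    "HOL-Analysis.Function_Topology"
    "HOL-Computational_Algebra.Primes"
    "HOL-Library.Poly_Mapping"
begin

section \<open>Indices and the Hoffman dual\<close>

definition is_index :: "nat list \<Rightarrow> bool" where
  "is_index ks \<longleftrightarrow> ks \<noteq> [] \<and> (\<forall>k\<in>set ks. k \<ge> 1)"

text \<open>Words on the letters 0 and 1 are lists of Booleans, with \<^term>\<open>False\<close> for 0 and
  \<^term>\<open>True\<close> for 1.\<close>

definition index_word :: "nat list \<Rightarrow> bool list" where
  "index_word ks = concat (map (\<lambda>k. replicate (k - 1) False @ [True]) ks)"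

definition hoffman_dual :: "nat list \<Rightarrow> nat list" where
  "hoffman_dual ks =
     (THE ks'. is_index ks' \<and> index_word ks' = map Not (butlast (index_word ks)) @ [True])"


section \<open>Products, direct sums and projective limits of rings\<close>

definition prod_ring :: "'i set \<Rightarrow> ('i \<Rightarrow> 'a ring) \<Rightarrow> ('i \<Rightarrow> 'a) ring" where
  "prod_ring I R =
     \<lparr>carrier = (\<Pi>\<^sub>E i\<in>I. carrier (R i)),
      monoid.mult = (\<lambda>x y. \<lambda>i\<in>I. x i \<otimes>\<^bsub>R i\<^esub> y i),
      one = (\<lambda>i\<in>I. \<one>\<^bsub>R i\<^esub>),
      zero = (\<lambda>i\<in>I. \<zero>\<^bsub>R i\<^esub>),
      add = (\<lambda>x y. \<lambda>i\<in>I. x i \<oplus>\<^bsub>R i\<^esub> y i)\<rparr>"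

definition direct_sum :: "'i set \<Rightarrow> ('i \<Rightarrow> 'a ring) \<Rightarrow> ('i \<Rightarrow> 'a) set" where
  "direct_sum I R = {x \<in> carrier (prod_ring I R). finite {i\<in>I. x i \<noteq> \<zero>\<^bsub>R i\<^esub>}}"

text \<open>The limit of a system indexed by the positive integers, where \<open>f n\<close> is the transition map
  from \<open>R (Suc n)\<close> to \<open>R n\<close>.\<close>

definition proj_lim :: "(nat \<Rightarrow> 'a ring) \<Rightarrow> (nat \<Rightarrow> 'a \<Rightarrow> 'a) \<Rightarrow> (nat \<Rightarrow> 'a) ring" where
  "proj_lim R f =
     (prod_ring {1..} R)
       \<lparr>carrier := {x \<in> carrier (prod_ring {1..} R). \<forall>n\<ge>1. f n (x (Suc n)) = x n}\<rparr>"

text \<open>If \<open>f\<close> is a ring homomorphism from \<open>R\<close> to \<open>S\<close> that maps the ideal \<open>I\<close> into the ideal \<open>J\<close>,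
  then the induced map from \<open>R Quot I\<close> to \<open>S Quot J\<close> sends a coset \<open>X\<close> to the coset \<open>J + f X\<close>.\<close>

definition induced_map :: "('b, 'm) ring_scheme \<Rightarrow> 'b set \<Rightarrow> ('a \<Rightarrow> 'b) \<Rightarrow> 'a set \<Rightarrow> 'b set" where
  "induced_map S J f X = J <+>\<^bsub>S\<^esub> (f ` X)"


section \<open>The \<open>p\<close>-adic completion of a ring\<close>

definition ppow_ideal :: "'a ring \<Rightarrow> nat \<Rightarrow> nat \<Rightarrow> 'a set" where
  "ppow_ideal R p n = PIdl\<^bsub>R\<^esub> ([(p ^ n)] \<cdot>\<^bsub>R\<^esub> \<one>\<^bsub>R\<^esub>)"

definition ppow_mod :: "'a ring \<Rightarrow> nat \<Rightarrow> nat \<Rightarrow> 'a set ring" where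
  "ppow_mod R p n = R Quot (ppow_ideal R p n)"

definition ppow_mod_red :: "'a ring \<Rightarrow> nat \<Rightarrow> nat \<Rightarrow> 'a set \<Rightarrow> 'a set" where
  "ppow_mod_red R p n = induced_map R (ppow_ideal R p n) (\<lambda>a. a)"

definition padic_ring :: "'a ring \<Rightarrow> nat \<Rightarrow> (nat \<Rightarrow> 'a set) ring" where
  "padic_ring R p = proj_lim (ppow_mod R p) (ppow_mod_red R p)"

definition to_padic :: "'a ring \<Rightarrow> nat \<Rightarrow> 'a \<Rightarrow> nat \<Rightarrow> 'a set" where
  "to_padic R p a = (\<lambda>n\<in>{1..}. ppow_ideal R p n +>\<^bsub>R\<^esub> a)"


section \<open>The rings \<open>A\<^sub>n\<close> and their limit\<close>

abbreviation primes :: "nat set" where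
  "primes \<equiv> {p. prime p}"

definition A_prod :: "'a ring \<Rightarrow> nat \<Rightarrow> (nat \<Rightarrow> 'a set) ring" where
  "A_prod R n = prod_ring primes (\<lambda>p. ppow_mod R p n)"

definition A_sum :: "'a ring \<Rightarrow> nat \<Rightarrow> (nat \<Rightarrow> 'a set) set" where
  "A_sum R n = direct_sum primes (\<lambda>p. ppow_mod R p n)"

definition A_ring :: "'a ring \<Rightarrow> nat \<Rightarrow> (nat \<Rightarrow> 'a set) set ring" where
  "A_ring R n = A_prod R n Quot A_sum R n"

definition A_red :: "'a ring \<Rightarrow> nat \<Rightarrow> (nat \<Rightarrow> 'a set) set \<Rightarrow> (nat \<Rightarrow> 'a set) set" where
  "A_red R n = induced_map (A_prod R n) (A_sum R n) (\<lambda>x. \<lambda>p\<in>primes. ppow_mod_red R p n (x p))"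

definition A_hat :: "'a ring \<Rightarrow> (nat \<Rightarrow> (nat \<Rightarrow> 'a set) set) ring" where
  "A_hat R = proj_lim (A_ring R) (A_red R)"

definition A_hat_topology :: "'a ring \<Rightarrow> (nat \<Rightarrow> (nat \<Rightarrow> 'a set) set) topology" where
  "A_hat_topology R =
     subtopology (product_topology (\<lambda>n. discrete_topology (carrier (A_ring R n))) {1..})
       (carrier (A_hat R))"

text \<open>The natural surjection, applied to a family \<open>x\<close> with \<open>x p\<close> in \<^term>\<open>padic_ring R p\<close> for
  every prime \<open>p\<close>.\<close>

definition A_hat_pi :: "'a ring \<Rightarrow> (nat \<Rightarrow> nat \<Rightarrow> 'a set) \<Rightarrow> nat \<Rightarrow> (nat \<Rightarrow> 'a set) set" where
  "A_hat_pi R x = (\<lambda>n\<in>{1..}. A_sum R n +>\<^bsub>A_prod R n\<^esub> (\<lambda>p\<in>primes. x p n))"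

definition A_hat_p :: "'a ring \<Rightarrow> nat \<Rightarrow> (nat \<Rightarrow> 'a set) set" where
  "A_hat_p R = A_hat_pi R (\<lambda>p. [p] \<cdot>\<^bsub>padic_ring R p\<^esub> \<one>\<^bsub>padic_ring R p\<^esub>)"

definition A_hat_half :: "'a ring \<Rightarrow> nat \<Rightarrow> (nat \<Rightarrow> 'a set) set" where
  "A_hat_half R = inv\<^bsub>A_hat R\<^esub> (\<one>\<^bsub>A_hat R\<^esub> \<oplus>\<^bsub>A_hat R\<^esub> \<one>\<^bsub>A_hat R\<^esub>)"

definition A_hat_suminf ::
    "'a ring \<Rightarrow> (nat \<Rightarrow> nat \<Rightarrow> (nat \<Rightarrow> 'a set) set) \<Rightarrow> nat \<Rightarrow> (nat \<Rightarrow> 'a set) set" where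
  "A_hat_suminf R a =
     (THE L. limitin (A_hat_topology R) (\<lambda>N. \<Oplus>\<^bsub>A_hat R\<^esub>i\<in>{..<N}. a i) L sequentially)"


section \<open>Shuffle star-multiple polylogarithms\<close>

definition star_tuples :: "nat \<Rightarrow> nat \<Rightarrow> nat list set" where
  "star_tuples N m = {ns. length ns = m \<and> sorted_wrt (\<ge>) ns \<and> set ns \<subseteq> {1..N}}"

text \<open>The finite sum is formed in a ring \<open>R\<close> in which \<open>1, \<dots>, N\<close> are invertible. Appending 0 to
  \<open>ns\<close> makes the exponent of the last argument the last entry of \<open>ns\<close>.\<close>

definition li_sh_star :: "('a, 'm) ring_scheme \<Rightarrow> nat \<Rightarrow> nat list \<Rightarrow> 'a list \<Rightarrow> 'a" where
  "li_sh_star R N ks ss =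
     (\<Oplus>\<^bsub>R\<^esub>ns\<in>star_tuples N (length ks).
        \<Otimes>\<^bsub>R\<^esub>j\<in>{..<length ks}.
          (ss ! j) [^]\<^bsub>R\<^esub> ((ns @ [0]) ! j - (ns @ [0]) ! Suc j)
            \<otimes>\<^bsub>R\<^esub> inv\<^bsub>R\<^esub> ([((ns ! j) ^ (ks ! j))] \<cdot>\<^bsub>R\<^esub> \<one>\<^bsub>R\<^esub>))"

definition li_sh_star_A ::
    "'a ring \<Rightarrow> nat list \<Rightarrow> 'a list \<Rightarrow> nat \<Rightarrow> (nat \<Rightarrow> 'a set) set" where
  "li_sh_star_A R ks ss =
     A_hat_pi R (\<lambda>p. li_sh_star (padic_ring R p) (p - 1) ks (map (to_padic R p) ss))"

definition L_star_A ::
    "'a ring \<Rightarrow> nat list \<Rightarrow> 'a list \<Rightarrow> nat \<Rightarrow> (nat \<Rightarrow> 'a set) set" where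
  "L_star_A R ks ss =
     A_hat_suminf R (\<lambda>i.
       (li_sh_star_A R (replicate i 1 @ ks) (replicate i \<one>\<^bsub>R\<^esub> @ ss)
          \<ominus>\<^bsub>A_hat R\<^esub> A_hat_half R
            \<otimes>\<^bsub>A_hat R\<^esub> li_sh_star_A R (replicate i 1 @ ks) (replicate i \<one>\<^bsub>R\<^esub> @ butlast ss @ [\<one>\<^bsub>R\<^esub>]))
       \<otimes>\<^bsub>A_hat R\<^esub> A_hat_p R [^]\<^bsub>A_hat R\<^esub> i)"


section \<open>The polynomial ring \<open>\<int>[t\<^sub>1, \<dots>, t\<^sub>r]\<close>\<close>

text \<open>The type consists of the integer polynomials in indeterminates indexed by all natural
  numbers: a monomial is a finitely supported map from indeterminates to exponents, and a
  polynomial a finitely supported map from monomials to coefficients.\<close>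

type_synonym zpoly = "(nat \<Rightarrow>\<^sub>0 nat) \<Rightarrow>\<^sub>0 int"

definition Zt :: "nat \<Rightarrow> zpoly ring" where
  "Zt r =
     \<lparr>carrier = {P. \<forall>m\<in>Poly_Mapping.keys P. Poly_Mapping.keys m \<subseteq> {1..r}},
      monoid.mult = (*), one = 1, zero = 0, add = (+)\<rparr>"

definition indet :: "nat \<Rightarrow> zpoly" where
  "indet i = Poly_Mapping.single (Poly_Mapping.single i 1) 1"

end

theory Submission
  imports
    Defs
    "HOL-Algebra.Subrings"
    "HOL-Analysis.T1_Spaces"
    "HOL-Analysis.Abstract_Topological_Spaces"
    "HOL-Computational_Algebra.Fraction_Field"
begin

text \<open>Writing each zero letter of the word of an index as summation with argument \<open>0\<close> and each
  letter one as summation with argument \<open>1\<close> or \<open>t\<^sub>i\<close>, the inner sums of a star polylogarithm are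
  obtained by applying operators \<open>f \<mapsto> (\<lambda>n. 1/n \<Sum>j\<le>n. s ^ (n - j) * f j)\<close>. The binomial transform
  turns the operator of \<open>s\<close> into that of \<open>1 - s\<close>, which exchanges zeros and ones and replaces \<open>t\<^sub>i\<close>
  by \<open>1 - t\<^sub>i\<close>: this is the Hoffman dual. The series over \<open>i\<close> introduces the factor
  \<open>\<Prod>a=n..p-1. 1/(1 - p/a) = (-1)^(p-n) * ((p-1) choose (n-1))\<close>, so that for odd \<open>p\<close> its sum is the
  binomial transform at \<open>p\<close> with the term \<open>n = p\<close> removed. After the correction by one half, this
  sum is symmetric under the duality already in \<open>\<rat>(t\<^sub>1, \<dots>, t\<^sub>r)\<close>, for each odd prime \<open>p\<close> separately.\<close>

section \<open>The binomial transform\<close>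

text \<open>The duality compares values at \<open>p\<close> of sequences that divide by their index,
  so it contains divisions by \<open>p\<close> and has no direct meaning in the
  \<open>p\<close>-adic completion. It is therefore proved in the fraction field, made a field of
  characteristic zero here, and carried over through the subring of \<open>p\<close>-integral
  elements by the relation \<open>rep\<close>. No limit is taken in the field: each series is cut
  after \<open>N\<close> terms, with an explicit remainder \<open>p^N\<close> times a
  \<open>p\<close>-integral element, which vanishes modulo \<open>p^n\<close> as soon as
  \<open>n <= N\<close>. The one half comes from the innermost sum. There the transform does not
  simply replace \<open>t\<close> by \<open>1 - t\<close>: since \<open>(1 - (1 - t)^n) / n\<close>
  appears, it produces the value for last letter \<open>1\<close> minus the value for
  \<open>1 - t\<close>. The surplus does not depend on \<open>t\<close>, and half of the value at
  \<open>t = 1\<close> corrects it on both sides at once. The prime \<open>2\<close> is set aside: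
  there the signs do not match and \<open>2\<close> is no unit.\<close>

instance fract :: ("{idom,ring_char_0}") field_char_0
proof
  show "inj (of_nat :: nat \<Rightarrow> 'a fract)"
    by (auto simp: inj_def of_nat_fract eq_fract)
qed

text \<open>At \<open>n = 0\<close> the division by zero yields \<open>0\<close>; this enforces the
  bound \<open>n_m >= 1\<close> on the summation variables although the inner sum starts at
  \<open>j = 0\<close>.\<close>

definition star_op :: "'a::field \<Rightarrow> (nat \<Rightarrow> 'a) \<Rightarrow> nat \<Rightarrow> 'a" where
  "star_op s f n = (\<Sum>j\<le>n. s ^ (n - j) * f j) / of_nat n"

text \<open>The indicator of \<open>0\<close> acts as a further summation variable fixed at
  \<open>0\<close> behind the last one, so that the last letter \<open>s\<close> contributes
  \<open>s^n\<close>. The first letter is applied last, and the argument \<open>n\<close> is the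
  value of the outermost variable.\<close>

definition star_seq :: "'a::field list \<Rightarrow> nat \<Rightarrow> 'a" where
  "star_seq u = foldr star_op u (\<lambda>n. if n = 0 then 1 else 0)"

text \<open>The signed binomial transform for sequences starting at index \<open>1\<close>, whence
  the shifts \<open>n - 1\<close> and \<open>Suc m\<close>.\<close>

definition binom_trans :: "(nat \<Rightarrow> 'a::field) \<Rightarrow> nat \<Rightarrow> 'a" where
  "binom_trans f n = (\<Sum>m<n. (-1) ^ m * of_nat ((n - 1) choose m) * f (Suc m))"

lemma star_seq_Nil: "star_seq [] = (\<lambda>n. if n = 0 then 1 else 0)"
  and star_seq_Cons: "star_seq (a # u) = star_op a (star_seq u)"
  by (simp_all add: star_seq_def)

lemma star_op_0 [simp]: "star_op s f 0 = 0"
  by (simp add: star_op_def)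

lemma star_seq_singleton: "star_seq [s] n = (if n = 0 then 0 else s ^ n / of_nat n)"
  by (simp add: star_seq_Nil star_seq_Cons star_op_def if_distrib sum.delta cong: if_cong)

lemma sum_powers_Suc:
  "(\<Sum>j\<le>Suc n. s ^ (Suc n - j) * f j) = s * (\<Sum>j\<le>n. s ^ (n - j) * f j) + (f (Suc n) :: 'a::comm_ring_1)"
  by (simp add: sum_distrib_left Suc_diff_le mult.assoc)

lemma star_op_diff: "star_op s (\<lambda>n. f n - g n) n = star_op s f n - star_op s g n"
  by (simp add: star_op_def algebra_simps sum_subtractf diff_divide_distrib)

lemma star_op_zero [simp]: "star_op 0 f n = f n / of_nat n"
proof -
  have "(\<Sum>j\<le>n. 0 ^ (n - j) * f j) = (\<Sum>j\<le>n. if j = n then f n else 0)"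
    by (intro sum.cong) auto
  then show ?thesis by (simp add: star_op_def)
qed

text \<open>Absorption: the factor \<open>1 / (m + 1)\<close> inside the transform becomes
  \<open>1 / (n + 1)\<close> outside it, so the divisions in \<open>star_op\<close> match on both
  sides.\<close>

lemma choose_divide_Suc:
  "of_nat (n choose m) / of_nat (Suc m) = of_nat (Suc n choose Suc m) / (of_nat (Suc n) :: 'a::field_char_0)"
  using arg_cong[OF Suc_times_binomial[of m n], of "of_nat :: nat \<Rightarrow> 'a", unfolded of_nat_mult]
  by (simp add: divide_eq_eq eq_divide_eq mult.commute of_nat_neq_0 del: of_nat_Suc binomial_Suc_Suc)

text \<open>After absorption only convolutions with powers remain to be compared, and such a
  convolution is determined by a first order recurrence. Pascal's rule for the coefficients of
  \<open>B\<close> and the recurrence of \<open>h\<close> combine to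
  \<open>B (n + 1) = (1 - s) * B n + binom_trans f (n + 1)\<close>.\<close>

lemma binom_trans_star_op:
  fixes f :: "nat \<Rightarrow> 'a::field_char_0"
  assumes "f 0 = 0"
  shows "binom_trans (star_op s f) = star_op (1 - s) (binom_trans f)"
proof
  fix N
  define h where "h n = (\<Sum>j\<le>n. s ^ (n - j) * f j)" for n
  define B where "B n = (\<Sum>m<n. (-1) ^ m * of_nat (n choose Suc m) * h (Suc m))" for n
  have h_Suc: "h (Suc n) = s * h n + f (Suc n)" for n
    unfolding h_def by (rule sum_powers_Suc)
  have h0: "h 0 = 0" using assms by (simp add: h_def)
  have B_Suc: "B (Suc n) = binom_trans h (Suc n) + B n" for n
    by (simp add: B_def binom_trans_def ring_distribs sum.distrib add.assoc)
  \<comment> \<open>The term \<open>m = 0\<close> vanishes by \<open>h 0 = 0\<close>, which is where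
    \<open>f 0 = 0\<close> enters; shifting \<open>m\<close> produces the sign.\<close>
  have shift: "(\<Sum>m<Suc n. (-1) ^ m * of_nat (n choose m) * h m) = - B n" for n
    by (simp add: B_def h0 sum.lessThan_Suc_shift sum_negf del: sum.lessThan_Suc)
  have bt: "binom_trans h (Suc n) = binom_trans f (Suc n) - s * B n" for n
  proof -
    have "binom_trans h (Suc n) = binom_trans f (Suc n) + s * (\<Sum>m<Suc n. (-1) ^ m * of_nat (n choose m) * h m)"
      unfolding binom_trans_def h_Suc
      by (simp add: algebra_simps sum.distrib sum_distrib_left del: sum.lessThan_Suc)
    then show ?thesis by (simp only: shift) simp
  qed
  have B: "B n = (\<Sum>j\<le>n. (1 - s) ^ (n - j) * binom_trans f j)" for n
  proof (induction n)
    case 0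
    show ?case by (simp add: B_def binom_trans_def)
  next
    case (Suc n)
    show ?case
      unfolding sum_powers_Suc Suc.IH[symmetric] B_Suc bt by (simp add: algebra_simps)
  qed
  have "binom_trans (star_op s f) N = B N / of_nat N"
  proof (cases N)
    case (Suc n)
    have "binom_trans (star_op s f) N =
        (\<Sum>m<N. (-1) ^ m * (of_nat (n choose m) / of_nat (Suc m)) * h (Suc m))"
      using Suc by (simp add: binom_trans_def star_op_def h_def)
    also have "\<dots> = B N / of_nat N"
      unfolding choose_divide_Suc B_def Suc
      by (simp add: sum_divide_distrib mult.assoc del: sum.lessThan_Suc binomial_Suc_Suc of_nat_Suc)
    finally show ?thesis .
  qed (simp add: binom_trans_def)
  then show "binom_trans (star_op s f) N = star_op (1 - s) (binom_trans f) N"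
    by (simp add: star_op_def B)
qed

text \<open>\<open>binom_trans_star_op\<close> does not apply to the last letter, because the seed
  of \<open>star_seq\<close> is not zero at \<open>0\<close>. For a single letter the binomial
  theorem gives \<open>(1 - (1 - t)^n) / n\<close>, a difference of two one-letter sequences;
  linearity carries it through the remaining letters.\<close>

lemma binom_trans_star_seq:
  fixes u :: "'a::field_char_0 list"
  shows "binom_trans (star_seq (u @ [t])) =
    (\<lambda>n. star_seq (map (\<lambda>x. 1 - x) u @ [1]) n - star_seq (map (\<lambda>x. 1 - x) u @ [1 - t]) n)"
proof (induction u)
  case Nil
  show ?case
  proof
    fix N
    show "binom_trans (star_seq ([] @ [t])) N = star_seq (map (\<lambda>x. 1 - x) [] @ [1]) N - star_seq (map (\<lambda>x. 1 - x) [] @ [1 - t]) N"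
    proof (cases N)
      case (Suc n)
      have "(1 - t) ^ N = (\<Sum>m\<le>Suc n. of_nat (Suc n choose m) * (- t) ^ m)"
        using binomial_ring[of "- t" 1 N] Suc by (simp add: add.commute del: sum.atMost_Suc)
      also have "\<dots> = 1 - (\<Sum>m<Suc n. (-1) ^ m * of_nat (Suc n choose Suc m) * t ^ Suc m)"
        unfolding sum.atMost_Suc_shift lessThan_Suc_atMost
        by (simp add: sum_negf power_minus[of t] mult_ac del: binomial_Suc_Suc sum.atMost_Suc)
      finally have pow: "(\<Sum>m<N. (-1) ^ m * of_nat (N choose Suc m) * t ^ Suc m) = 1 - (1 - t) ^ N"
        using Suc by simp
      have "binom_trans (star_seq [t]) N =
        (\<Sum>m<N. (-1) ^ m * (of_nat (n choose m) / of_nat (Suc m)) * t ^ Suc m)"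
        using Suc by (simp add: binom_trans_def star_seq_singleton)
      also have "\<dots> = (1 - (1 - t) ^ N) / of_nat N"
        unfolding choose_divide_Suc pow[symmetric] unfolding Suc by (simp only: sum_divide_distrib times_divide_eq_left times_divide_eq_right)
      finally show ?thesis using Suc by (simp add: star_seq_singleton diff_divide_distrib del: of_nat_Suc)
    qed (simp add: binom_trans_def star_seq_singleton)
  qed
next
  case (Cons a u)
  have "star_seq (u @ [t]) 0 = 0" by (cases u) (simp_all add: star_seq_Cons)
  then show ?case
    by (auto simp: star_seq_Cons binom_trans_star_op Cons.IH star_op_diff)
qed

lemma star_seq_0: "u \<noteq> [] \<Longrightarrow> star_seq u 0 = 0"
  by (cases u) (simp_all add: star_seq_Cons)

text \<open>The seed for \<open>0\<close> is \<open>0^n / n\<close>, which is zero for every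
  \<open>n\<close>, at \<open>n = 0\<close> by the division convention. Words ending in
  \<open>0\<close> arise when a last letter \<open>1\<close> is complemented.\<close>

lemma star_seq_append_zero: "star_seq (u @ [0]) n = 0"
proof (induction u arbitrary: n)
  case Nil
  show ?case by (simp add: star_seq_singleton)
qed (simp add: star_seq_Cons star_op_def)

text \<open>For odd \<open>p\<close> the terms for \<open>n = p\<close> cancel, so no denominator divisible by \<open>p\<close> occurs.\<close>

definition dual_val :: "nat \<Rightarrow> 'a::field list \<Rightarrow> 'a" where
  "dual_val p u = binom_trans (star_seq u) p - star_seq u p"

text \<open>Let \<open>Y s\<close> be the value of \<open>star_seq\<close> at \<open>p\<close> for
  \<open>u @ [s]\<close>, and \<open>X s\<close> that for the complemented \<open>u\<close> followed
  by \<open>s\<close>. Since \<open>X 0 = Y 0 = 0\<close>, both sides equal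
  \<open>(X 1 + Y 1) / 2 - X (1 - t) - Y t\<close>, which is invariant under exchanging
  \<open>X\<close> with \<open>Y\<close> and \<open>t\<close> with \<open>1 - t\<close>.\<close>

lemma dual_val_symmetric:
  fixes u :: "'a::field_char_0 list"
  shows "dual_val p (u @ [t]) - dual_val p (u @ [1]) / 2 =
    dual_val p (map (\<lambda>x. 1 - x) u @ [1 - t]) - dual_val p (map (\<lambda>x. 1 - x) u @ [1]) / 2"
  by (simp add: dual_val_def binom_trans_star_seq star_seq_append_zero o_def field_simps)

section \<open>Words of indices\<close>

lemma is_index_Cons: "is_index (k # ks) \<longleftrightarrow> k \<ge> 1 \<and> (ks = [] \<or> is_index ks)"
  by (auto simp: is_index_def)

lemma index_word_Nil: "index_word [] = []"
  and index_word_Cons: "index_word (k # ks) = replicate (k - 1) False @ True # index_word ks"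
  by (simp_all add: index_word_def)

lemma replicate_append_eqD:
  "x \<noteq> y \<Longrightarrow> replicate m x @ y # u = replicate n x @ y # v \<Longrightarrow> m = n \<and> u = v"
proof (induction m arbitrary: n)
  case 0
  then show ?case by (cases n) auto
next
  case (Suc m)
  then show ?case by (cases n) auto
qed

lemma index_word_inj:
  "\<lbrakk>\<forall>k\<in>set ks. k \<ge> 1; \<forall>k\<in>set ls. k \<ge> 1; index_word ks = index_word ls\<rbrakk> \<Longrightarrow> ks = ls"
proof (induction ks arbitrary: ls)
  case Nil
  then show ?case by (cases ls) (auto simp: index_word_Nil index_word_Cons)
next
  case (Cons k ks)
  from Cons.prems obtain l ls' where ls: "ls = l # ls'"
    by (cases ls) (auto simp: index_word_Nil index_word_Cons)
  with Cons.prems have "k - 1 = l - 1 \<and> index_word ks = index_word ls'"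
    by (intro replicate_append_eqD[of False True]) (auto simp: index_word_Cons)
  moreover have "k \<ge> 1" "l \<ge> 1" using Cons.prems ls by auto
  ultimately show ?case using Cons.IH[of ls'] Cons.prems ls by auto
qed

lemma index_word_surj: "\<exists>ks. is_index ks \<and> index_word ks = w @ [True]"
proof (induction w)
  case Nil
  show ?case by (rule exI[of _ "[1]"]) (simp add: is_index_def index_word_def)
next
  case (Cons b w)
  then obtain k ks where ks: "is_index (k # ks)" "index_word (k # ks) = w @ [True]"
    by (metis is_index_def neq_Nil_conv)
  show ?case
  proof (cases b)
    case True
    then show ?thesis
      using ks by (intro exI[of _ "1 # k # ks"]) (simp add: is_index_Cons index_word_Cons)
  next
    case False
    then show ?thesis
      using ks by (intro exI[of _ "Suc k # ks"]) (cases k; simp add: is_index_Cons index_word_Cons)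
  qed
qed

lemma hoffman_dual:
  "is_index (hoffman_dual ks)" (is ?A)
  "index_word (hoffman_dual ks) = map Not (butlast (index_word ks)) @ [True]" (is ?B)
proof -
  have "\<exists>!ks'. is_index ks' \<and> index_word ks' = map Not (butlast (index_word ks)) @ [True]"
    using index_word_surj index_word_inj by (metis is_index_def)
  from theI'[OF this] show ?A ?B unfolding hoffman_dual_def by blast+
qed

text \<open>The word of an index with each letter 1 replaced by the argument attached to it. Read as
  letters of \<open>star_seq\<close>, the \<open>k - 1\<close> letters \<open>0\<close> are mere
  divisions by \<open>n\<close> and raise the denominator to \<open>n^k\<close>.\<close>

fun arg_word :: "nat list \<Rightarrow> 'a::zero list \<Rightarrow> 'a list" where
  "arg_word (k # ks) (s # ss) = replicate (k - 1) 0 @ s # arg_word ks ss"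
| "arg_word _ _ = []"

lemma arg_word_append:
  "length ks = length ss \<Longrightarrow> arg_word (ks @ ks') (ss @ ss') = arg_word ks ss @ arg_word ks' ss'"
  by (induction ks ss rule: list_induct2) auto

lemma arg_word_concat:
  assumes "\<And>x. x \<in> set xs \<Longrightarrow> length (f x) = length (g x)"
  shows "arg_word (concat (map f xs)) (concat (map g xs)) = concat (map (\<lambda>x. arg_word (f x) (g x)) xs)"
  using assms by (induction xs) (simp_all add: arg_word_append)

lemma arg_word_replicate_1:
  "arg_word (replicate i 1 @ ks) (replicate i s @ ss) = replicate i s @ arg_word ks ss"
  by (induction i) auto

text \<open>The last argument occupies exactly the last letter, so replacing it by \<open>1\<close>,
  as in the subtracted half of the series, leaves the prefix \<open>u\<close> unchanged. This is the
  shape required by \<open>dual_val_symmetric\<close>.\<close>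

lemma arg_word_snoc:
  assumes "length ks = length ss" "ss \<noteq> []"
  obtains u where "\<And>t. arg_word ks (butlast ss @ [t]) = u @ [t]" "arg_word ks ss = u @ [last ss]"
proof -
  obtain ks' k where "ks = ks' @ [k]" using assms by (cases ks rule: rev_cases) auto
  then have "arg_word ks (butlast ss @ [t]) = (arg_word ks' (butlast ss) @ replicate (k - 1) 0) @ [t]" for t
    using assms by (simp add: arg_word_append)
  with assms(2) that show ?thesis by (metis append_butlast_last_id)
qed

lemma set_arg_word: "set (arg_word ks ss) \<subseteq> insert 0 (set ss)"
  by (induction ks ss rule: arg_word.induct) auto

lemma arg_word_block:
  assumes "is_index ks"
  shows "arg_word ks (replicate (length ks - 1) 1 @ [t]) =
    map (\<lambda>b. if b then 1 else 0) (butlast (index_word ks)) @ [t :: 'a::zero_neq_one]"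
  using assms
proof (induction ks)
  case (Cons k ks)
  show ?case
  proof (cases ks)
    case Nil
    then show ?thesis by (simp add: index_word_Cons index_word_Nil butlast_append)
  next
    case (Cons l ls)
    have "index_word ks \<noteq> []" using Cons by (simp add: index_word_Cons)
    moreover have "is_index ks" using Cons Cons.prems by (simp add: is_index_Cons)
    ultimately show ?thesis
      using Cons.IH Cons by (simp add: index_word_Cons butlast_append)
  qed
qed (simp add: is_index_def)

text \<open>Within a block the arguments \<open>1\<close> make the word literally the 0-1 word of
  the index, with \<open>t\<close> in place of its final 1. Hence the single map from
  \<open>x\<close> to \<open>1 - x\<close> performs both the exchange of letters in the Hoffman dual
  and the substitution of \<open>1 - t\<close> for \<open>t\<close>.\<close>

lemma arg_word_hoffman_dual:
  assumes "is_index ks"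
  shows "arg_word (hoffman_dual ks) (replicate (length (hoffman_dual ks) - 1) 1 @ [1 - t]) =
    map (\<lambda>x. 1 - x) (arg_word ks (replicate (length ks - 1) 1 @ [t :: 'a::comm_ring_1]))"
  unfolding arg_word_block[OF assms] arg_word_block[OF hoffman_dual(1)] hoffman_dual(2)
  by (auto simp: butlast_append)

section \<open>Star polylogarithms over a field\<close>

lemma star_seq_replicate_zero:
  "star_seq (replicate m 0 @ s # u) n = (\<Sum>j\<le>n. s ^ (n - j) * star_seq u j) / of_nat n ^ Suc m"
  by (induction m) (simp_all add: star_seq_Cons star_op_def[of s] divide_divide_eq_left' mult.commute)

definition li_term :: "nat list \<Rightarrow> 'a::field list \<Rightarrow> nat list \<Rightarrow> 'a" where
  "li_term ks ss ns = (\<Prod>j<length ks.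
     ss ! j ^ ((ns @ [0]) ! j - (ns @ [0]) ! Suc j) / of_nat (ns ! j ^ ks ! j))"

lemma li_term_Nil: "li_term [] [] ns = 1"
  and li_term_Cons: "li_term (k # ks) (s # ss) (n # ns) =
    s ^ (n - (ns @ [0]) ! 0) / of_nat n ^ k * li_term ks ss ns"
  by (simp_all add: li_term_def prod.lessThan_Suc_shift del: prod.lessThan_Suc)

lemma finite_star_tuples: "finite (star_tuples N m)"
  by (rule finite_subset[OF _ finite_lists_length_eq[of "{1..N}" m]]) (auto simp: star_tuples_def)

lemma star_tuples_0: "star_tuples N 0 = {[]}"
  and star_tuples_Suc: "star_tuples N (Suc m) = (\<Union>n\<in>{1..N}. (#) n ` star_tuples n m)"
proof -
  show "star_tuples N 0 = {[]}" by (auto simp: star_tuples_def)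
  show "star_tuples N (Suc m) = (\<Union>n\<in>{1..N}. (#) n ` star_tuples n m)"
  proof (intro equalityI subsetI)
    fix x assume "x \<in> star_tuples N (Suc m)"
    then obtain n ns where "x = n # ns" "n \<in> {1..N}" "ns \<in> star_tuples n m"
      by (cases x) (auto simp: star_tuples_def subset_iff)
    then show "x \<in> (\<Union>n\<in>{1..N}. (#) n ` star_tuples n m)" by blast
  next
    fix x assume "x \<in> (\<Union>n\<in>{1..N}. (#) n ` star_tuples n m)"
    then show "x \<in> star_tuples N (Suc m)"
      by (fastforce simp: star_tuples_def)
  qed
qed

lemma sum_star_tuples_Suc:
  "(\<Sum>ns\<in>star_tuples N (Suc m). f ns) = (\<Sum>n\<in>{1..N}. \<Sum>ns\<in>star_tuples n m. f (n # ns))"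
  unfolding star_tuples_Suc
  by (subst sum.UNION_disjoint) (auto simp: finite_star_tuples sum.reindex inj_on_def)

text \<open>The factor with base \<open>x\<close> is there for the induction: removing the first
  entry \<open>n\<close> of a tuple leaves a sum of the same kind, with \<open>N\<close> and
  \<open>x\<close> replaced by \<open>n\<close> and the first argument \<open>s\<close>. The case
  \<open>x = 1\<close> is the one of interest.\<close>

lemma sum_li_term:
  assumes "length ks = length ss" "\<forall>k\<in>set ks. k \<ge> 1"
  shows "(\<Sum>ns\<in>star_tuples N (length ks). x ^ (N - (ns @ [0]) ! 0) * li_term ks ss ns) =
    (\<Sum>j\<le>N. x ^ (N - j) * star_seq (arg_word ks ss) j)"
  using assms
proof (induction ks ss arbitrary: N x rule: list_induct2)
  case Nil
  have "(\<Sum>j\<le>N. x ^ (N - j) * (if j = 0 then 1 else 0)) = (\<Sum>j\<le>N. if j = 0 then x ^ N else 0)"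
    by (intro sum.cong) auto
  then show ?case by (simp add: star_tuples_0 li_term_Nil star_seq_Nil)
next
  case (Cons k ks s ss)
  from Cons.prems have k: "k = Suc (k - 1)" by simp
  have "(\<Sum>ns\<in>star_tuples N (length (k # ks)). x ^ (N - (ns @ [0]) ! 0) * li_term (k # ks) (s # ss) ns) =
     (\<Sum>n\<in>{1..N}. x ^ (N - n) * ((\<Sum>j\<le>n. s ^ (n - j) * star_seq (arg_word ks ss) j) / of_nat n ^ k))"
    using Cons.prems
    by (simp add: sum_star_tuples_Suc li_term_Cons sum_divide_distrib sum_distrib_left flip: Cons.IH)
  also have "\<dots> = (\<Sum>n\<in>{1..N}. x ^ (N - n) * star_seq (arg_word (k # ks) (s # ss)) n)"
    using k by (simp add: star_seq_replicate_zero)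
  also have "\<dots> = (\<Sum>n\<le>N. x ^ (N - n) * star_seq (arg_word (k # ks) (s # ss)) n)"
    by (intro sum.mono_neutral_left) (auto simp: star_seq_0 not_less_eq_eq)
  finally show ?case .
qed

definition li_star :: "nat \<Rightarrow> nat list \<Rightarrow> 'a::field list \<Rightarrow> 'a" where
  "li_star N ks ss = (\<Sum>ns\<in>star_tuples N (length ks). li_term ks ss ns)"

lemma li_star_eq:
  assumes "length ks = length ss" "\<forall>k\<in>set ks. k \<ge> 1"
  shows "li_star N ks ss = (\<Sum>j\<le>N. star_seq (arg_word ks ss) j)"
  using sum_li_term[OF assms, of 1 N] by (simp add: li_star_def)

text \<open>The complete homogeneous symmetric polynomial of degree \<open>i\<close> in \<open>1 / j, \<dots>, 1 / N\<close>.\<close>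

primrec compl_hom :: "nat \<Rightarrow> nat \<Rightarrow> nat \<Rightarrow> 'a::field" where
  "compl_hom N 0 j = 1"
| "compl_hom N (Suc i) j = (\<Sum>n\<in>{j..N}. compl_hom N i n / of_nat n)"

text \<open>The \<open>i\<close> leading variables have argument \<open>1\<close> and exponent
  \<open>1\<close>, hence only the weights \<open>1 / n\<close>. Summing over them first, along all
  chains between the next variable and \<open>N\<close>, yields the complete homogeneous
  polynomial.\<close>

lemma sum_star_seq_replicate_1:
  "(\<Sum>n\<le>N. star_seq (replicate i 1 @ u) n) = (\<Sum>n\<le>N. compl_hom N i n * star_seq u n)"
proof (induction i arbitrary: u)
  case (Suc i)
  have "(\<Sum>n\<le>N. star_seq (replicate (Suc i) 1 @ u) n) = (\<Sum>n\<le>N. compl_hom N i n * star_seq (1 # u) n)"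
    using Suc.IH[of "1 # u"] by (metis append_Cons append_assoc append_Nil replicate_Suc replicate_append_same)
  also have "\<dots> = (\<Sum>n\<in>{..N}. \<Sum>j | j \<in> {..N} \<and> j \<le> n. compl_hom N i n / of_nat n * star_seq u j)"
    by (intro sum.cong refl) (auto simp: star_seq_Cons star_op_def sum_distrib_left sum_divide_distrib intro!: sum.cong)
  also have "\<dots> = (\<Sum>j\<in>{..N}. \<Sum>n | n \<in> {..N} \<and> j \<le> n. compl_hom N i n / of_nat n * star_seq u j)"
    by (intro sum.swap_restrict) auto
  also have "\<dots> = (\<Sum>j\<le>N. compl_hom N (Suc i) j * star_seq u j)"
    by (intro sum.cong refl) (auto simp: sum_distrib_right intro!: sum.cong)
  finally show ?case .
qed simp

text \<open>An abstract stand-in, inside the field, for the polynomials with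
  \<open>p\<close>-integral coefficients. Congruences modulo \<open>p^n\<close> are stated as
  equations with a remainder \<open>p^n * z\<close> where \<open>z\<close> is in
  \<open>L\<close>.\<close>

locale local_subring =
  fixes p :: nat and L :: "'a::field_char_0 set"
  assumes prime: "prime p"
    and one: "1 \<in> L"
    and add: "\<lbrakk>x \<in> L; y \<in> L\<rbrakk> \<Longrightarrow> x + y \<in> L"
    and uminus: "x \<in> L \<Longrightarrow> - x \<in> L"
    and mult: "\<lbrakk>x \<in> L; y \<in> L\<rbrakk> \<Longrightarrow> x * y \<in> L"
    and divide: "\<lbrakk>x \<in> L; coprime d p\<rbrakk> \<Longrightarrow> x / of_nat d \<in> L"
begin

lemma zero: "0 \<in> L"
  using add[OF one uminus[OF one]] by simp

lemma diff: "\<lbrakk>x \<in> L; y \<in> L\<rbrakk> \<Longrightarrow> x - y \<in> L"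
  using add[OF _ uminus] by force

lemma sum: "(\<And>i. i \<in> A \<Longrightarrow> f i \<in> L) \<Longrightarrow> sum f A \<in> L"
  by (induction A rule: infinite_finite_induct) (auto intro: add zero)

lemma power: "x \<in> L \<Longrightarrow> x ^ n \<in> L"
  by (induction n) (auto intro: one mult)

lemma of_nat: "of_nat n \<in> L"
  by (induction n) (auto intro: zero one add)

lemma coprime: "\<lbrakk>0 < n; n < p\<rbrakk> \<Longrightarrow> coprime n p"
  using prime by (metis coprime_commute nat_dvd_not_less prime_imp_coprime_nat)

lemma compl_hom: "0 < j \<Longrightarrow> compl_hom (p - 1) i j \<in> L"
proof (induction i arbitrary: j)
  case (Suc i)
  have "compl_hom (p - 1) i n / of_nat n \<in> L" if "n \<in> {j..p - 1}" for n
    using that Suc prime_gt_0_nat[OF prime] by (intro divide Suc.IH coprime) auto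
  then show ?case by (auto intro: sum)
qed (simp add: one)

lemma star_seq: "\<lbrakk>set u \<subseteq> L; n < p\<rbrakk> \<Longrightarrow> star_seq u n \<in> L"
proof (induction u arbitrary: n)
  case (Cons s u)
  have "(\<Sum>j\<le>n. s ^ (n - j) * star_seq u j) \<in> L"
    using Cons by (intro sum mult power Cons.IH) auto
  then show ?case
    using Cons.prems coprime[of n] by (cases "n = 0") (auto simp: star_seq_Cons star_op_def intro: zero divide)
qed (auto simp: star_seq_Nil zero one)

text \<open>Downward induction on \<open>j\<close>: passing from \<open>j + 1\<close> to
  \<open>j\<close> multiplies the full product by \<open>1 / (1 - p/j) = - j / (p - j)\<close>, and
  the signed binomial coefficient changes by the same factor. Truncation only adds a multiple of
  \<open>p^n\<close>, and dividing it by \<open>p - j\<close>, which is prime to \<open>p\<close>,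
  keeps the cofactor \<open>p\<close>-integral.\<close>

lemma sum_compl_hom:
  assumes "0 < n" "0 < j" "j \<le> p"
  shows "\<exists>z\<in>L. (\<Sum>i<n. of_nat p ^ i * compl_hom (p - 1) i j) =
    (-1) ^ (p - j) * of_nat ((p - 1) choose (j - 1)) + of_nat p ^ n * z"
  using assms(3,2)
proof (induction j rule: inc_induct)
  case base
  \<comment> \<open>The range \<open>{p..p - 1}\<close> is empty, so only the constant term
    survives.\<close>
  have "compl_hom (p - 1) i p = (if i = 0 then 1 else 0 :: 'a)" for i
    using assms by (cases i) auto
  note this[unfolded One_nat_def, simp]
  show ?case
    using assms(1) by (intro bexI[of _ 0]) (auto simp: if_distrib sum.delta zero cong: if_cong)
next
  case (step j)
  define S where "S j = (\<Sum>i<n. of_nat p ^ i * compl_hom (p - 1) i j :: 'a)" for j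
  define G where "G j = (-1) ^ (p - j) * (of_nat ((p - 1) choose (j - 1)) :: 'a)" for j
  define F where "F = (compl_hom (p - 1) (n - 1) j :: 'a)"
  obtain n' where n': "n = Suc n'" using assms by (cases n) auto
  from step obtain z where z: "z \<in> L" "S (Suc j) = G (Suc j) + of_nat p ^ n * z"
    by (auto simp: S_def G_def)
  have j: "0 < j" "j < p" using step by auto
  \<comment> \<open>Separates the monomials divisible by \<open>1 / j\<close> from the
    others.\<close>
  have compl_hom_rec: "of_nat j * compl_hom (p - 1) (Suc i) j =
      of_nat j * compl_hom (p - 1) (Suc i) (Suc j) + (compl_hom (p - 1) i j :: 'a)" for i
  proof -
    have "{j..p - 1} = insert j {Suc j..p - 1}" using j by auto
    then show ?thesis using j by (simp add: field_simps)
  qed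
  \<comment> \<open>The term \<open>i = 0\<close> is \<open>1\<close> for every \<open>l\<close>, so
    the recurrence is needed only for the shifted terms.\<close>
  have S_head: "of_nat j * S l = of_nat j + (\<Sum>i<n'. of_nat p ^ Suc i * (of_nat j * compl_hom (p - 1) (Suc i) l))" for l
    unfolding S_def n' sum.lessThan_Suc_shift
    by (simp add: sum_distrib_left ring_distribs mult.left_commute[of "of_nat j"]
        del: compl_hom.simps(2) power_Suc)
  have "of_nat j * S j = of_nat j * S (Suc j) + (\<Sum>i<n'. of_nat p ^ Suc i * compl_hom (p - 1) i j)"
    unfolding S_head by (simp only: compl_hom_rec ring_distribs sum.distrib add.assoc)
  \<comment> \<open>\<open>F\<close> is the top coefficient: multiplying the truncated sum by
    \<open>p\<close> pushes it to degree \<open>n\<close>, outside the range kept.\<close>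
  moreover have "of_nat p * S j = (\<Sum>i<n'. of_nat p ^ Suc i * compl_hom (p - 1) i j) + of_nat p ^ n * F"
    by (simp add: S_def F_def n' sum_distrib_left algebra_simps)
  ultimately have S: "(of_nat p - of_nat j) * S j = - (of_nat j * S (Suc j)) + of_nat p ^ n * F"
    by (simp add: algebra_simps)
  have G: "(of_nat p - of_nat j) * G j = - (of_nat j * G (Suc j))"
  proof -
    obtain m where m: "j = Suc m" using j by (cases j) auto
    have "(p - j) * ((p - 1) choose m) = j * ((p - 1) choose j)"
      using binomial_absorb_comp[of "p - 1" m] binomial_absorption[of m "p - 1"] m by simp
    from arg_cong[OF this, of "of_nat :: nat \<Rightarrow> 'a"]
    have *: "(of_nat p - of_nat j) * of_nat ((p - 1) choose m) = (of_nat j * of_nat ((p - 1) choose j) :: 'a)"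
      using j by (simp add: of_nat_diff)
    have sign: "(-1) ^ (p - j) = - ((-1) ^ (p - Suc j) :: 'a)"
      using j by (simp add: Suc_diff_Suc[symmetric])
    have "(of_nat p - of_nat j) * G j = (-1) ^ (p - j) * ((of_nat p - of_nat j) * of_nat ((p - 1) choose m))"
      by (simp add: G_def m algebra_simps)
    also have "\<dots> = - (of_nat j * G (Suc j))"
      unfolding * sign by (simp add: G_def algebra_simps)
    finally show ?thesis .
  qed
  \<comment> \<open>The new remainder, found by subtracting the recurrences of \<open>S\<close> and
    \<open>G\<close>: their difference leaves \<open>p^n * (F - j * z)\<close>, and the divisor
    \<open>p - j\<close> lies strictly between \<open>0\<close> and \<open>p\<close>.\<close>
  define w where "w = (F - of_nat j * z) / of_nat (p - j)"
  have "w \<in> L"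
    unfolding w_def F_def using z j
    by (intro divide diff mult of_nat compl_hom coprime) auto
  moreover have "S j = G j + of_nat p ^ n * w"
  proof -
    have nz: "of_nat p - of_nat j \<noteq> (0 :: 'a)" using j by simp
    have "(of_nat p - of_nat j) * w = F - of_nat j * z"
      using j by (simp add: w_def of_nat_diff)
    then have "(of_nat p - of_nat j) * (G j + of_nat p ^ n * w) =
        - (of_nat j * G (Suc j)) + of_nat p ^ n * (F - of_nat j * z)"
      by (simp add: distrib_left G mult.left_commute[of _ "of_nat p ^ n"])
    also have "\<dots> = (of_nat p - of_nat j) * S j"
      unfolding S z by (simp add: algebra_simps)
    finally show ?thesis using nz by simp
  qed
  ultimately show ?case by (auto simp: S_def G_def)
qed

text \<open>Summing over \<open>i\<close> first leaves a finite sum in which each weight is replaced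
  by its value from \<open>sum_compl_hom\<close>. The remainders are multiplied by values
  \<open>f j\<close> with \<open>0 < j < p\<close>, which are \<open>p\<close>-integral, so together
  they form a multiple of \<open>p^n\<close>.\<close>

lemma sum_li_star:
  assumes "odd p" "0 < n" "length ks = length ss" "\<forall>k\<in>set ks. k \<ge> 1" "ks \<noteq> []" "set ss \<subseteq> L"
  shows "\<exists>z\<in>L. (\<Sum>i<n. li_star (p - 1) (replicate i 1 @ ks) (replicate i 1 @ ss) * of_nat p ^ i) =
    dual_val p (arg_word ks ss) + of_nat p ^ n * z"
proof -
  define f where "f = star_seq (arg_word ks ss)"
  have ne: "arg_word ks ss \<noteq> []"
    using assms(3,5) by (cases ks; cases ss) auto
  have f: "f j \<in> L" if "j < p" for j
    unfolding f_def using assms(6) set_arg_word[of ks ss] zero that by (intro star_seq) auto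
  have li: "li_star (p - 1) (replicate i 1 @ ks) (replicate i 1 @ ss) =
      (\<Sum>m<p - 1. compl_hom (p - 1) i (Suc m) * f (Suc m))" for i
  proof -
    have "li_star (p - 1) (replicate i 1 @ ks) (replicate i 1 @ ss) =
      (\<Sum>m\<le>p - 1. compl_hom (p - 1) i m * f m)"
      using assms by (subst li_star_eq) (auto simp: arg_word_replicate_1[unfolded One_nat_def] sum_star_seq_replicate_1 f_def)
    then show ?thesis
      using star_seq_0[OF ne]
      by (simp add: f_def lessThan_Suc_atMost[symmetric] sum.lessThan_Suc_shift del: sum.lessThan_Suc)
  qed
  have "\<forall>m\<in>{..<p - 1}. \<exists>z\<in>L. (\<Sum>i<n. of_nat p ^ i * compl_hom (p - 1) i (Suc m)) =
      (-1) ^ m * of_nat ((p - 1) choose m) + of_nat p ^ n * z"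
  proof
    fix m assume m: "m \<in> {..<p - 1}"
    \<comment> \<open>As \<open>p\<close> is odd, the sign depends on \<open>m\<close> alone and is
      the one in \<open>binom_trans\<close>.\<close>
    have "(-1) ^ (p - Suc m) = ((-1) ^ m :: 'a)"
      using assms(1) m by (auto simp: minus_one_power_iff)
    with sum_compl_hom[of n "Suc m"] m assms(2) show "\<exists>z\<in>L. (\<Sum>i<n. of_nat p ^ i * compl_hom (p - 1) i (Suc m)) =
      (-1) ^ m * of_nat ((p - 1) choose m) + of_nat p ^ n * z" by simp
  qed
  then obtain z where z: "\<And>m. m < p - 1 \<Longrightarrow> z m \<in> L"
    and eq: "\<And>m. m < p - 1 \<Longrightarrow> (\<Sum>i<n. of_nat p ^ i * compl_hom (p - 1) i (Suc m)) =
      (-1) ^ m * of_nat ((p - 1) choose m) + of_nat p ^ n * z m"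
    by (metis lessThan_iff)
  have "(\<Sum>i<n. li_star (p - 1) (replicate i 1 @ ks) (replicate i 1 @ ss) * of_nat p ^ i) =
      (\<Sum>m<p - 1. (\<Sum>i<n. of_nat p ^ i * compl_hom (p - 1) i (Suc m)) * f (Suc m))"
    unfolding li sum_distrib_right by (subst sum.swap) (simp add: mult_ac)
  also have "\<dots> = (\<Sum>m<p - 1. (-1) ^ m * of_nat ((p - 1) choose m) * f (Suc m))
      + of_nat p ^ n * (\<Sum>m<p - 1. z m * f (Suc m))"
    by (simp add: eq[unfolded One_nat_def] ring_distribs sum.distrib sum_distrib_left mult.assoc)
  \<comment> \<open>The term \<open>m = p - 1\<close> missing here would be \<open>f p\<close> with
    sign \<open>+1\<close>, exactly what \<open>dual_val\<close> subtracts.\<close>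
  also have "(\<Sum>m<p - 1. (-1) ^ m * of_nat ((p - 1) choose m) * f (Suc m)) = dual_val p (arg_word ks ss)"
  proof -
    obtain q where "p = Suc q" using assms(1) by (cases p) auto
    with assms(1) show ?thesis by (simp add: dual_val_def binom_trans_def f_def)
  qed
  finally show ?thesis
    using z f by (intro bexI[of _ "\<Sum>m<p - 1. z m * f (Suc m)"]) (auto intro!: sum mult)
qed

end

section \<open>Products, inverse systems and quotients of rings\<close>

lemma ring_hom_cring_of_hom:
  "\<lbrakk>cring R; cring S; h \<in> ring_hom R S\<rbrakk> \<Longrightarrow> ring_hom_cring R S h"
  by (simp add: ring_hom_cring_def ring_hom_cring_axioms_def)

lemma prod_ring_eqI:
  assumes "x \<in> carrier (prod_ring I R)" "y \<in> carrier (prod_ring I R)" "\<And>i. i \<in> I \<Longrightarrow> x i = y i"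
  shows "x = y"
  using assms by (auto simp: prod_ring_def intro: PiE_ext)

lemma prod_ring_mem: "\<lbrakk>x \<in> carrier (prod_ring I R); i \<in> I\<rbrakk> \<Longrightarrow> x i \<in> carrier (R i)"
  by (auto simp: prod_ring_def)

lemma prod_ring_memI: "(\<And>i. i \<in> I \<Longrightarrow> x i \<in> carrier (R i)) \<Longrightarrow> (\<lambda>i\<in>I. x i) \<in> carrier (prod_ring I R)"
  by (auto simp: prod_ring_def)

lemma prod_ring_apply:
  assumes "i \<in> I"
  shows "(x \<oplus>\<^bsub>prod_ring I R\<^esub> y) i = x i \<oplus>\<^bsub>R i\<^esub> y i" "(x \<otimes>\<^bsub>prod_ring I R\<^esub> y) i = x i \<otimes>\<^bsub>R i\<^esub> y i"
    "\<zero>\<^bsub>prod_ring I R\<^esub> i = \<zero>\<^bsub>R i\<^esub>" "\<one>\<^bsub>prod_ring I R\<^esub> i = \<one>\<^bsub>R i\<^esub>"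
  using assms by (simp_all add: prod_ring_def)

lemma prod_ring_cring:
  assumes "\<And>i. i \<in> I \<Longrightarrow> cring (R i)"
  shows "cring (prod_ring I R)"
proof -
  let ?P = "prod_ring I R"
  have r_one: "x \<otimes>\<^bsub>R i\<^esub> \<one>\<^bsub>R i\<^esub> = x" if "i \<in> I" "x \<in> carrier (R i)" for x i
  proof -
    interpret cring "R i" using that(1) by (rule assms)
    show ?thesis using that(2) by simp
  qed
  note simprules = cring.cring_simprules[OF assms] r_one
  have add: "x \<oplus>\<^bsub>?P\<^esub> y \<in> carrier ?P" and mult: "x \<otimes>\<^bsub>?P\<^esub> y \<in> carrier ?P"
    if "x \<in> carrier ?P" "y \<in> carrier ?P" for x y
    using that by (auto simp: prod_ring_def PiE_iff simprules)
  have zero: "\<zero>\<^bsub>?P\<^esub> \<in> carrier ?P" and one: "\<one>\<^bsub>?P\<^esub> \<in> carrier ?P"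
    by (auto simp: prod_ring_def simprules)
  show ?thesis
  proof (rule cringI)
    show "abelian_group ?P"
    proof (rule abelian_groupI)
      fix x assume x: "x \<in> carrier ?P"
      let ?y = "\<lambda>i\<in>I. \<ominus>\<^bsub>R i\<^esub> x i"
      have "?y \<in> carrier ?P"
        using prod_ring_mem[OF x] by (intro prod_ring_memI) (simp add: simprules)
      moreover have "?y \<oplus>\<^bsub>?P\<^esub> x = \<zero>\<^bsub>?P\<^esub>"
        using prod_ring_mem[OF x] by (auto simp: prod_ring_def simprules intro!: restrict_ext)
      ultimately show "\<exists>y\<in>carrier ?P. y \<oplus>\<^bsub>?P\<^esub> x = \<zero>\<^bsub>?P\<^esub>" by blast
    qed (auto intro!: prod_ring_eqI[of _ I R] add zero simp: prod_ring_apply,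
        auto simp: simprules prod_ring_mem)
    show "Group.comm_monoid ?P"
      by (rule comm_monoidI) (auto intro!: prod_ring_eqI[of _ I R] mult one simp: prod_ring_apply,
        auto simp: simprules prod_ring_mem)
    show "(x \<oplus>\<^bsub>?P\<^esub> y) \<otimes>\<^bsub>?P\<^esub> z = x \<otimes>\<^bsub>?P\<^esub> z \<oplus>\<^bsub>?P\<^esub> y \<otimes>\<^bsub>?P\<^esub> z"
      if "x \<in> carrier ?P" "y \<in> carrier ?P" "z \<in> carrier ?P" for x y z
      using that by (intro prod_ring_eqI[of _ I R] add mult) (simp_all add: prod_ring_apply simprules prod_ring_mem)
  qed
qed

lemma prod_ring_proj_hom: "i \<in> I \<Longrightarrow> (\<lambda>x. x i) \<in> ring_hom (prod_ring I R) (R i)"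
  by (rule ring_hom_memI) (auto simp: prod_ring_apply prod_ring_mem)

lemma prod_ring_map_hom:
  assumes "\<And>i. i \<in> I \<Longrightarrow> h i \<in> ring_hom (R i) (S i)"
  shows "(\<lambda>x. \<lambda>i\<in>I. h i (x i)) \<in> ring_hom (prod_ring I R) (prod_ring I S)"
  by (rule ring_hom_memI)
    (auto intro!: prod_ring_memI restrict_ext
      simp: prod_ring_apply prod_ring_mem ring_hom_closed[OF assms] ring_hom_mult[OF assms]
        ring_hom_add[OF assms] ring_hom_one[OF assms], auto simp: prod_ring_def
        prod_ring_mem ring_hom_closed[OF assms] ring_hom_mult[OF assms]
        ring_hom_add[OF assms] ring_hom_one[OF assms] intro!: restrict_ext)

lemma direct_sum_ideal:
  assumes "\<And>i. i \<in> I \<Longrightarrow> cring (R i)"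
  shows "ideal (direct_sum I R) (prod_ring I R)"
proof -
  interpret P: cring "prod_ring I R" by (rule prod_ring_cring[OF assms])
  have proj: "ring_hom_cring (prod_ring I R) (R i) (\<lambda>x. x i)" if "i \<in> I" for i
    by (rule ring_hom_cring_of_hom[OF P.is_cring assms[OF that] prod_ring_proj_hom[OF that]])
  note simprules = cring.cring_simprules[OF assms]
  \<comment> \<open>Membership is tested against any finite set containing the support, which spares
    computing supports exactly.\<close>
  have mem: "x \<in> direct_sum I R"
    if "x \<in> carrier (prod_ring I R)" "finite A" "\<And>i. \<lbrakk>i \<in> I; i \<notin> A\<rbrakk> \<Longrightarrow> x i = \<zero>\<^bsub>R i\<^esub>" for x A
    using that by (auto simp: direct_sum_def intro: finite_subset)
  show ?thesis
  proof (rule idealI)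
    show "subgroup (direct_sum I R) (add_monoid (prod_ring I R))"
    proof (rule P.add.subgroupI)
      show "direct_sum I R \<noteq> {}"
        using mem[of "\<zero>\<^bsub>prod_ring I R\<^esub>" "{}"] by (auto simp: prod_ring_apply)
      show "\<ominus>\<^bsub>prod_ring I R\<^esub> x \<in> direct_sum I R" if "x \<in> direct_sum I R" for x
      proof (rule mem[of _ "{i\<in>I. x i \<noteq> \<zero>\<^bsub>R i\<^esub>}"])
        fix i assume i: "i \<in> I" "i \<notin> {i\<in>I. x i \<noteq> \<zero>\<^bsub>R i\<^esub>}"
        interpret ring_hom_cring "prod_ring I R" "R i" "\<lambda>x. x i" by (rule proj[OF i(1)])
        show "(\<ominus>\<^bsub>prod_ring I R\<^esub> x) i = \<zero>\<^bsub>R i\<^esub>"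
          using that i by (simp add: direct_sum_def)
      qed (use that in \<open>auto simp: direct_sum_def\<close>)
      show "x \<oplus>\<^bsub>prod_ring I R\<^esub> y \<in> direct_sum I R" if "x \<in> direct_sum I R" "y \<in> direct_sum I R" for x y
        using that by (intro mem[of _ "{i\<in>I. x i \<noteq> \<zero>\<^bsub>R i\<^esub>} \<union> {i\<in>I. y i \<noteq> \<zero>\<^bsub>R i\<^esub>}"])
          (auto simp: direct_sum_def prod_ring_apply simprules)
    qed (auto simp: direct_sum_def)
    fix a x assume *: "a \<in> direct_sum I R" "x \<in> carrier (prod_ring I R)"
    then have a: "a \<in> carrier (prod_ring I R)" by (simp add: direct_sum_def)
    show "x \<otimes>\<^bsub>prod_ring I R\<^esub> a \<in> direct_sum I R"
      using * by (intro mem[of _ "{i\<in>I. a i \<noteq> \<zero>\<^bsub>R i\<^esub>}"])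
        (auto simp: direct_sum_def prod_ring_apply simprules prod_ring_mem)
    then show "a \<otimes>\<^bsub>prod_ring I R\<^esub> x \<in> direct_sum I R"
      using * a by (simp add: P.m_comm)
  qed (rule P.ring_axioms)
qed

section \<open>Limits of inverse systems\<close>

locale inverse_system =
  fixes R :: "nat \<Rightarrow> 'a ring" and f :: "nat \<Rightarrow> 'a \<Rightarrow> 'a"
  assumes cring: "n \<ge> 1 \<Longrightarrow> cring (R n)"
    and hom: "n \<ge> 1 \<Longrightarrow> f n \<in> ring_hom (R (Suc n)) (R n)"
begin

lemma proj_lim_carrier:
  "x \<in> carrier (proj_lim R f) \<longleftrightarrow>
    x \<in> carrier (prod_ring {1..} R) \<and> (\<forall>n\<ge>1. f n (x (Suc n)) = x n)"
  by (simp add: proj_lim_def)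

lemma proj_lim_cring: "cring (proj_lim R f)"
proof -
  let ?P = "prod_ring {1..} R" and ?L = "carrier (proj_lim R f)"
  interpret P: cring ?P by (rule prod_ring_cring) (simp add: cring)
  have proj: "ring_hom_cring ?P (R n) (\<lambda>x. x n)" if "n \<ge> 1" for n
    using that by (intro ring_hom_cring_of_hom P.is_cring cring prod_ring_proj_hom) auto
  have f: "ring_hom_cring (R (Suc n)) (R n) (f n)" if "n \<ge> 1" for n
    using that by (intro ring_hom_cring_of_hom cring hom) auto
  have "subcring ?L ?P"
  proof (rule P.subcringI'[OF P.subringI])
    show "?L \<subseteq> carrier ?P" by (auto simp: proj_lim_carrier)
    show "\<one>\<^bsub>?P\<^esub> \<in> ?L"
      using P.one_closed by (auto simp: proj_lim_carrier prod_ring_apply ring_hom_one[OF hom])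
    fix x assume x: "x \<in> ?L"
    then have xP: "x \<in> carrier ?P" by (simp add: proj_lim_carrier)
    have "f n ((\<ominus>\<^bsub>?P\<^esub> x) (Suc n)) = (\<ominus>\<^bsub>?P\<^esub> x) n" if n: "n \<ge> 1" for n
    proof -
      interpret a: ring_hom_cring ?P "R (Suc n)" "\<lambda>x. x (Suc n)" using n by (intro proj) auto
      interpret b: ring_hom_cring ?P "R n" "\<lambda>x. x n" using n by (rule proj)
      interpret c: ring_hom_cring "R (Suc n)" "R n" "f n" using n by (rule f)
      show ?thesis using x xP n by (simp add: proj_lim_carrier prod_ring_mem del: One_nat_def)
    qed
    then show "\<ominus>\<^bsub>?P\<^esub> x \<in> ?L" using xP by (simp add: proj_lim_carrier del: One_nat_def)
    fix y assume y: "y \<in> ?L"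
    show "x \<oplus>\<^bsub>?P\<^esub> y \<in> ?L" "x \<otimes>\<^bsub>?P\<^esub> y \<in> ?L"
      using x y
      by (auto simp: proj_lim_carrier prod_ring_apply prod_ring_mem ring_hom_add[OF hom] ring_hom_mult[OF hom]
          simp del: One_nat_def)
  qed
  then show ?thesis
    using P.subcring_iff[of ?L] by (auto simp: proj_lim_def)
qed

lemma proj_lim_apply:
  assumes "n \<ge> 1"
  shows "(x \<oplus>\<^bsub>proj_lim R f\<^esub> y) n = x n \<oplus>\<^bsub>R n\<^esub> y n" "(x \<otimes>\<^bsub>proj_lim R f\<^esub> y) n = x n \<otimes>\<^bsub>R n\<^esub> y n"
    "\<zero>\<^bsub>proj_lim R f\<^esub> n = \<zero>\<^bsub>R n\<^esub>" "\<one>\<^bsub>proj_lim R f\<^esub> n = \<one>\<^bsub>R n\<^esub>"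
  using assms by (simp_all add: proj_lim_def prod_ring_def)

lemma proj_lim_mem: "\<lbrakk>x \<in> carrier (proj_lim R f); n \<ge> 1\<rbrakk> \<Longrightarrow> x n \<in> carrier (R n)"
  by (auto simp: proj_lim_carrier prod_ring_mem)

lemma proj_lim_proj: "n \<ge> 1 \<Longrightarrow> ring_hom_cring (proj_lim R f) (R n) (\<lambda>x. x n)"
  by (intro ring_hom_cring_of_hom proj_lim_cring cring ring_hom_memI)
    (auto simp: proj_lim_apply proj_lim_mem)

lemma proj_lim_eqI:
  assumes "x \<in> carrier (proj_lim R f)" "y \<in> carrier (proj_lim R f)" "\<And>n. n \<ge> 1 \<Longrightarrow> x n = y n"
  shows "x = y"
  using assms by (auto simp: proj_lim_carrier intro: prod_ring_eqI[of _ "{1..}" R])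

lemma proj_lim_homI:
  assumes "\<And>n. n \<ge> 1 \<Longrightarrow> (\<lambda>x. h x n) \<in> ring_hom S (R n)"
    and "\<And>x. x \<in> carrier S \<Longrightarrow> h x \<in> extensional {1..}"
    and "\<And>x n. \<lbrakk>x \<in> carrier S; n \<ge> 1\<rbrakk> \<Longrightarrow> f n (h x (Suc n)) = h x n"
    and "cring S"
  shows "h \<in> ring_hom S (proj_lim R f)"
proof -
  interpret S: cring S by fact
  interpret P: cring "proj_lim R f" by (rule proj_lim_cring)
  have h: "h x \<in> carrier (proj_lim R f)" if "x \<in> carrier S" for x
    using assms that by (auto simp: proj_lim_carrier prod_ring_def PiE_iff ring_hom_closed[OF assms(1)])
  show ?thesis
    by (rule ring_hom_memI)
      (auto intro!: proj_lim_eqI h simp: proj_lim_apply ring_hom_add[OF assms(1)] ring_hom_mult[OF assms(1)]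
        ring_hom_one[OF assms(1)])
qed

text \<open>Inverses are unique and preserved by homomorphisms, so the inverses at the separate
  levels are compatible with the transition maps and form an element of the limit.\<close>

lemma proj_lim_Units:
  assumes "x \<in> carrier (proj_lim R f)" "\<And>n. n \<ge> 1 \<Longrightarrow> x n \<in> Units (R n)"
  shows "x \<in> Units (proj_lim R f)"
proof -
  interpret P: cring "proj_lim R f" by (rule proj_lim_cring)
  define y where "y = (\<lambda>n\<in>{1..}. inv\<^bsub>R n\<^esub> x n)"
  have inv: "inv\<^bsub>R n\<^esub> x n \<in> carrier (R n)" "x n \<otimes>\<^bsub>R n\<^esub> inv\<^bsub>R n\<^esub> x n = \<one>\<^bsub>R n\<^esub>" if "n \<ge> 1" for n
  proof -
    interpret cring "R n" using that by (rule cring)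
    show "inv\<^bsub>R n\<^esub> x n \<in> carrier (R n)" "x n \<otimes>\<^bsub>R n\<^esub> inv\<^bsub>R n\<^esub> x n = \<one>\<^bsub>R n\<^esub>"
      using assms(2)[OF that] by auto
  qed
  have "f n (inv\<^bsub>R (Suc n)\<^esub> x (Suc n)) = inv\<^bsub>R n\<^esub> x n" if n: "n \<ge> 1" for n
  proof -
    interpret ring_hom_cring "R (Suc n)" "R n" "f n"
      using n by (intro ring_hom_cring_of_hom cring hom) auto
    have "x n = f n (x (Suc n))" using assms(1) n by (simp add: proj_lim_carrier)
    then have "x n \<otimes>\<^bsub>R n\<^esub> f n (inv\<^bsub>R (Suc n)\<^esub> x (Suc n)) = \<one>\<^bsub>R n\<^esub>"
      using inv[of "Suc n"] proj_lim_mem[OF assms(1), of "Suc n"] by (simp flip: hom_mult)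
    then show ?thesis
      using inv[of "Suc n"] proj_lim_mem[OF assms(1) n] by (intro S.comm_inv_char[symmetric]) auto
  qed
  then have "y \<in> carrier (proj_lim R f)"
    using inv by (auto simp: proj_lim_carrier y_def intro!: prod_ring_memI)
  moreover have "x \<otimes>\<^bsub>proj_lim R f\<^esub> y = \<one>\<^bsub>proj_lim R f\<^esub>"
    using inv assms(1) \<open>y \<in> carrier _\<close>
    by (intro proj_lim_eqI) (auto simp: proj_lim_apply y_def)
  ultimately show ?thesis
    using assms(1) P.m_comm[of x y] unfolding Units_def by fastforce
qed

end

section \<open>Quotient rings and induced maps\<close>

lemma FactRing_carrierE:
  assumes "X \<in> carrier (R Quot I)"
  obtains a where "a \<in> carrier R" "X = I +>\<^bsub>R\<^esub> a"
  using assms by (auto simp: FactRing_def A_RCOSETS_def')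

lemma induced_map_coset:
  assumes "ideal I R" "ideal J S" "h \<in> ring_hom R S" "h ` I \<subseteq> J" "a \<in> carrier R"
  shows "induced_map S J h (I +>\<^bsub>R\<^esub> a) = J +>\<^bsub>S\<^esub> h a"
proof -
  interpret I: ideal I R by fact
  interpret J: ideal J S by fact
  have "h (i \<oplus>\<^bsub>R\<^esub> a) = h i \<oplus>\<^bsub>S\<^esub> h a" if "i \<in> I" for i
    using assms that by (simp add: ring_hom_add[OF assms(3)])
  then have *: "induced_map S J h (I +>\<^bsub>R\<^esub> a) = {j \<oplus>\<^bsub>S\<^esub> (h i \<oplus>\<^bsub>S\<^esub> h a) | i j. i \<in> I \<and> j \<in> J}"
    by (auto simp: induced_map_def a_r_coset_def' set_add_def')
  have ha: "h a \<in> carrier S" using assms by (simp add: ring_hom_closed)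
  show ?thesis
    unfolding *
  proof (intro equalityI subsetI)
    fix y assume "y \<in> {j \<oplus>\<^bsub>S\<^esub> (h i \<oplus>\<^bsub>S\<^esub> h a) | i j. i \<in> I \<and> j \<in> J}"
    then obtain i j where ij: "i \<in> I" "j \<in> J" "y = j \<oplus>\<^bsub>S\<^esub> (h i \<oplus>\<^bsub>S\<^esub> h a)" by blast
    then have "h i \<in> J" using assms(4) by blast
    with ij ha have "y = (j \<oplus>\<^bsub>S\<^esub> h i) \<oplus>\<^bsub>S\<^esub> h a" "j \<oplus>\<^bsub>S\<^esub> h i \<in> J" by (simp_all add: J.a_assoc)
    then show "y \<in> J +>\<^bsub>S\<^esub> h a" by (auto simp: a_r_coset_def')
  next
    fix y assume "y \<in> J +>\<^bsub>S\<^esub> h a"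
    then obtain j where j: "j \<in> J" "y = j \<oplus>\<^bsub>S\<^esub> h a" by (auto simp: a_r_coset_def')
    \<comment> \<open>The witness in \<open>I\<close> is zero. As membership in
      \<open>ring_hom\<close> does not state that zero is preserved, \<open>j\<close> is corrected
      by \<open>h \<zero>\<close>, which lies in \<open>J\<close>.\<close>
    have h0: "h \<zero>\<^bsub>R\<^esub> \<in> J" using assms(4) by auto
    have "j \<oplus>\<^bsub>S\<^esub> h a = (j \<ominus>\<^bsub>S\<^esub> h \<zero>\<^bsub>R\<^esub>) \<oplus>\<^bsub>S\<^esub> (h \<zero>\<^bsub>R\<^esub> \<oplus>\<^bsub>S\<^esub> h a)"
      using j h0 ha J.ring_axioms J.a_Hcarr by (simp add: J.minus_eq J.a_assoc J.r_neg1 J.r_neg2)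
    moreover have "j \<ominus>\<^bsub>S\<^esub> h \<zero>\<^bsub>R\<^esub> \<in> J" using j h0 by (simp add: J.minus_eq)
    ultimately show "y \<in> {j \<oplus>\<^bsub>S\<^esub> (h i \<oplus>\<^bsub>S\<^esub> h a) | i j. i \<in> I \<and> j \<in> J}"
      using j by (auto intro!: exI[of _ "\<zero>\<^bsub>R\<^esub>"])
  qed
qed

lemma induced_map_hom:
  assumes "ideal I R" "ideal J S" "h \<in> ring_hom R S" "h ` I \<subseteq> J"
  shows "induced_map S J h \<in> ring_hom (R Quot I) (S Quot J)"
proof -
  interpret I: ideal I R by fact
  interpret J: ideal J S by fact
  note I_hom = I.rcos_ring_hom and J_hom = J.rcos_ring_hom
  note coset = induced_map_coset[OF assms]
  show ?thesis
  proof (rule ring_hom_memI)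
    show "induced_map S J h X \<in> carrier (S Quot J)" if "X \<in> carrier (R Quot I)" for X
      using that by (elim FactRing_carrierE)
        (simp add: coset ring_hom_closed[OF J_hom] ring_hom_closed[OF assms(3)])
    fix X Y assume "X \<in> carrier (R Quot I)" "Y \<in> carrier (R Quot I)"
    then obtain a b where ab: "a \<in> carrier R" "X = I +>\<^bsub>R\<^esub> a" "b \<in> carrier R" "Y = I +>\<^bsub>R\<^esub> b"
      by (metis FactRing_carrierE)
    show "induced_map S J h (X \<otimes>\<^bsub>R Quot I\<^esub> Y) = induced_map S J h X \<otimes>\<^bsub>S Quot J\<^esub> induced_map S J h Y"
      using ab by (simp add: coset ring_hom_closed[OF assms(3)] ring_hom_mult[OF assms(3)]
          flip: ring_hom_mult[OF I_hom] ring_hom_mult[OF J_hom])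
    show "induced_map S J h (X \<oplus>\<^bsub>R Quot I\<^esub> Y) = induced_map S J h X \<oplus>\<^bsub>S Quot J\<^esub> induced_map S J h Y"
      using ab by (simp add: coset ring_hom_closed[OF assms(3)] ring_hom_add[OF assms(3)]
          flip: ring_hom_add[OF I_hom] ring_hom_add[OF J_hom])
  next
    show "induced_map S J h \<one>\<^bsub>R Quot I\<^esub> = \<one>\<^bsub>S Quot J\<^esub>"
      by (simp add: coset ring_hom_one[OF assms(3)] flip: ring_hom_one[OF I_hom] ring_hom_one[OF J_hom])
  qed
qed

context cring
begin

lemma add_pow_one_mult: "[(m::nat)] \<cdot> \<one> \<otimes> [(n::nat)] \<cdot> \<one> = [(m * n)] \<cdot> \<one>"
  by (simp add: add_pow_ldistr add.nat_pow_pow mult.commute)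

end

lemma (in ring_hom_ring) hom_add_pow:
  "x \<in> carrier R \<Longrightarrow> h ([(n::nat)] \<cdot>\<^bsub>R\<^esub> x) = [n] \<cdot>\<^bsub>S\<^esub> h x"
  by (induction n) simp_all

section \<open>Completions of a coefficient ring\<close>

locale coefficient_ring = cring R for R :: "'a ring" (structure)
begin

lemma ppow_ideal: "ideal (ppow_ideal R p n) R"
  unfolding ppow_ideal_def by (rule cgenideal_ideal) simp

lemma ppow_ideal_iff: "x \<in> ppow_ideal R p n \<longleftrightarrow> (\<exists>a\<in>carrier R. x = a \<otimes> [(p ^ n)] \<cdot> \<one>)"
  by (auto simp: ppow_ideal_def cgenideal_def)

lemma ppow_ideal_coset: "a \<in> ppow_ideal R p n \<Longrightarrow> ppow_ideal R p n +> a = ppow_ideal R p n"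
  by (rule abelian_subgroup.a_rcos_const[OF abelian_subgroupI3[OF ideal.axioms(1)[OF ppow_ideal] is_abelian_group]])

lemma ppow_ideal_Suc_subset: "ppow_ideal R p (Suc n) \<subseteq> ppow_ideal R p n"
proof
  fix x assume "x \<in> ppow_ideal R p (Suc n)"
  then obtain a where a: "a \<in> carrier R" "x = a \<otimes> [(p ^ Suc n)] \<cdot> \<one>"
    by (auto simp: ppow_ideal_iff)
  then have "x = (a \<otimes> [p] \<cdot> \<one>) \<otimes> [(p ^ n)] \<cdot> \<one>"
    by (simp add: m_assoc add_pow_one_mult)
  then show "x \<in> ppow_ideal R p n" using a by (auto simp: ppow_ideal_iff)
qed

lemma ppow_mod_cring: "cring (ppow_mod R p n)"
  unfolding ppow_mod_def by (rule ideal.quotient_is_cring[OF ppow_ideal is_cring])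

lemma ppow_mod_coset_hom: "(+>) (ppow_ideal R p n) \<in> ring_hom R (ppow_mod R p n)"
  unfolding ppow_mod_def by (rule ideal.rcos_ring_hom[OF ppow_ideal])

lemma ppow_mod_coset_hom_cring: "ring_hom_cring R (ppow_mod R p n) ((+>) (ppow_ideal R p n))"
  by (intro ring_hom_cring_of_hom is_cring ppow_mod_cring ppow_mod_coset_hom)

lemma id_hom: "(\<lambda>a. a) \<in> ring_hom R R"
  by (rule ring_hom_memI) auto

lemma ppow_mod_red_coset:
  "a \<in> carrier R \<Longrightarrow> ppow_mod_red R p n (ppow_ideal R p (Suc n) +> a) = ppow_ideal R p n +> a"
  unfolding ppow_mod_red_def
  by (rule induced_map_coset[OF ppow_ideal ppow_ideal id_hom]) (use ppow_ideal_Suc_subset in auto)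

lemma ppow_mod_red_hom: "ppow_mod_red R p n \<in> ring_hom (ppow_mod R p (Suc n)) (ppow_mod R p n)"
  unfolding ppow_mod_red_def ppow_mod_def
  by (rule induced_map_hom[OF ppow_ideal ppow_ideal id_hom]) (use ppow_ideal_Suc_subset in auto)

lemma padic_system: "inverse_system (ppow_mod R p) (ppow_mod_red R p)"
  by (intro inverse_system.intro ppow_mod_cring ppow_mod_red_hom)

lemma padic_cring: "cring (padic_ring R p)"
  unfolding padic_ring_def by (rule inverse_system.proj_lim_cring[OF padic_system])

lemma padic_proj: "n \<ge> 1 \<Longrightarrow> ring_hom_cring (padic_ring R p) (ppow_mod R p n) (\<lambda>x. x n)"
  unfolding padic_ring_def by (rule inverse_system.proj_lim_proj[OF padic_system])

lemma to_padic_hom: "to_padic R p \<in> ring_hom R (padic_ring R p)"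
  unfolding padic_ring_def
  by (rule inverse_system.proj_lim_homI[OF padic_system])
    (auto simp: to_padic_def ppow_mod_coset_hom ppow_mod_red_coset is_cring)

lemma to_padic_hom_cring: "ring_hom_cring R (padic_ring R p) (to_padic R p)"
  by (intro ring_hom_cring_of_hom is_cring padic_cring to_padic_hom)

lemma ppow_mod_add_pow_zero: "[(p ^ n)] \<cdot>\<^bsub>ppow_mod R p n\<^esub> \<one>\<^bsub>ppow_mod R p n\<^esub> = \<zero>\<^bsub>ppow_mod R p n\<^esub>"
proof -
  interpret ring_hom_cring R "ppow_mod R p n" "(+>) (ppow_ideal R p n)" by (rule ppow_mod_coset_hom_cring)
  have "[(p ^ n)] \<cdot> \<one> \<in> ppow_ideal R p n"
    using ppow_ideal_iff by force
  then have "ppow_ideal R p n +> [(p ^ n)] \<cdot> \<one> = ppow_ideal R p n"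
    by (rule ppow_ideal_coset)
  then have "ppow_ideal R p n +> [(p ^ n)] \<cdot> \<one> = \<zero>\<^bsub>ppow_mod R p n\<^esub>"
    by (simp only: ppow_mod_def FactRing_def ring.simps)
  moreover have "ppow_ideal R p n +> [(p ^ n)] \<cdot> \<one> = [(p ^ n)] \<cdot>\<^bsub>ppow_mod R p n\<^esub> (ppow_ideal R p n +> \<one>)"
    by (rule ring.hom_add_pow) simp
  ultimately show ?thesis by (simp only: hom_one)
qed

text \<open>Bezout gives an inverse of \<open>d\<close> modulo \<open>p^n\<close> at every level,
  and \<open>proj_lim_Units\<close> assembles them.\<close>

lemma padic_Units:
  assumes "coprime d p" "d \<noteq> 0"
  shows "[d] \<cdot>\<^bsub>padic_ring R p\<^esub> \<one>\<^bsub>padic_ring R p\<^esub> \<in> Units (padic_ring R p)"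
proof -
  interpret P: cring "padic_ring R p" by (rule padic_cring)
  have "([d] \<cdot>\<^bsub>padic_ring R p\<^esub> \<one>\<^bsub>padic_ring R p\<^esub>) n \<in> Units (ppow_mod R p n)" if n: "n \<ge> 1" for n
  proof -
    interpret ring_hom_cring "padic_ring R p" "ppow_mod R p n" "\<lambda>x. x n" using n by (rule padic_proj)
    let ?S = "ppow_mod R p n"
    have "coprime d (p ^ n)" using assms by simp
    then have "gcd d (p ^ n) = 1" by (rule coprime_imp_gcd_eq_1)
    then obtain x y where "d * x = p ^ n * y + 1"
      using bezout_nat[OF assms(2), of "p ^ n"] by auto
    then have "[(d * x)] \<cdot>\<^bsub>?S\<^esub> \<one>\<^bsub>?S\<^esub> = [(p ^ n * y)] \<cdot>\<^bsub>?S\<^esub> \<one>\<^bsub>?S\<^esub> \<oplus>\<^bsub>?S\<^esub> \<one>\<^bsub>?S\<^esub>" by simp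
    then have "[d] \<cdot>\<^bsub>?S\<^esub> \<one>\<^bsub>?S\<^esub> \<otimes>\<^bsub>?S\<^esub> [x] \<cdot>\<^bsub>?S\<^esub> \<one>\<^bsub>?S\<^esub> = \<one>\<^bsub>?S\<^esub>"
      unfolding S.add_pow_one_mult[symmetric] by (simp add: ppow_mod_add_pow_zero)
    then have "[d] \<cdot>\<^bsub>?S\<^esub> \<one>\<^bsub>?S\<^esub> \<in> Units ?S"
      using S.m_comm[of "[d] \<cdot>\<^bsub>?S\<^esub> \<one>\<^bsub>?S\<^esub>" "[x] \<cdot>\<^bsub>?S\<^esub> \<one>\<^bsub>?S\<^esub>"] unfolding Units_def
      by (auto intro!: bexI[of _ "[x] \<cdot>\<^bsub>?S\<^esub> \<one>\<^bsub>?S\<^esub>"])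
    then show ?thesis by (simp add: ring.hom_add_pow)
  qed
  moreover have "[d] \<cdot>\<^bsub>padic_ring R p\<^esub> \<one>\<^bsub>padic_ring R p\<^esub> \<in> carrier (padic_ring R p)" by simp
  ultimately show ?thesis
    unfolding padic_ring_def by (intro inverse_system.proj_lim_Units[OF padic_system])
qed

text \<open>This makes the remainder of a partial sum with \<open>m\<close> terms invisible at all
  levels up to \<open>m\<close>.\<close>

lemma padic_ppow_mult_zero:
  assumes "n \<ge> 1" "n \<le> m" "w \<in> carrier (padic_ring R p)"
  shows "([(p ^ m)] \<cdot>\<^bsub>padic_ring R p\<^esub> \<one>\<^bsub>padic_ring R p\<^esub> \<otimes>\<^bsub>padic_ring R p\<^esub> w) n = \<zero>\<^bsub>ppow_mod R p n\<^esub>"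
proof -
  interpret ring_hom_cring "padic_ring R p" "ppow_mod R p n" "\<lambda>x. x n" using assms(1) by (rule padic_proj)
  have "p ^ m = p ^ n * p ^ (m - n)" using assms by (simp flip: power_add)
  then show ?thesis
    using assms(3) by (simp add: ring.hom_add_pow ppow_mod_add_pow_zero flip: S.add_pow_one_mult)
qed

lemma A_prod_cring: "cring (A_prod R n)"
  unfolding A_prod_def by (rule prod_ring_cring) (rule ppow_mod_cring)

lemma A_sum_ideal: "ideal (A_sum R n) (A_prod R n)"
  unfolding A_prod_def A_sum_def by (rule direct_sum_ideal) (rule ppow_mod_cring)

lemma A_ring_cring: "cring (A_ring R n)"
  unfolding A_ring_def by (rule ideal.quotient_is_cring[OF A_sum_ideal A_prod_cring])

lemma A_prod_red_hom:
  "(\<lambda>x. \<lambda>p\<in>primes. ppow_mod_red R p n (x p)) \<in> ring_hom (A_prod R (Suc n)) (A_prod R n)"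
  unfolding A_prod_def by (rule prod_ring_map_hom) (rule ppow_mod_red_hom)

lemma A_prod_red_sum: "(\<lambda>x. \<lambda>p\<in>primes. ppow_mod_red R p n (x p)) ` A_sum R (Suc n) \<subseteq> A_sum R n"
proof safe
  fix x assume x: "x \<in> A_sum R (Suc n)"
  have "ppow_mod_red R p n \<zero>\<^bsub>ppow_mod R p (Suc n)\<^esub> = \<zero>\<^bsub>ppow_mod R p n\<^esub>" for p
  proof -
    interpret ring_hom_cring "ppow_mod R p (Suc n)" "ppow_mod R p n" "ppow_mod_red R p n"
      by (intro ring_hom_cring_of_hom ppow_mod_cring ppow_mod_red_hom)
    show ?thesis by simp
  qed
  then have "{p \<in> primes. (\<lambda>p\<in>primes. ppow_mod_red R p n (x p)) p \<noteq> \<zero>\<^bsub>ppow_mod R p n\<^esub>}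
      \<subseteq> {p \<in> primes. x p \<noteq> \<zero>\<^bsub>ppow_mod R p (Suc n)\<^esub>}" by auto
  moreover have "finite {p \<in> primes. x p \<noteq> \<zero>\<^bsub>ppow_mod R p (Suc n)\<^esub>}"
    using x unfolding A_sum_def direct_sum_def by blast
  ultimately have "finite {p \<in> primes. (\<lambda>p\<in>primes. ppow_mod_red R p n (x p)) p \<noteq> \<zero>\<^bsub>ppow_mod R p n\<^esub>}"
    by (rule finite_subset)
  moreover have "(\<lambda>p\<in>primes. ppow_mod_red R p n (x p)) \<in> carrier (A_prod R n)"
    using x by (intro ring_hom_closed[OF A_prod_red_hom]) (simp add: A_sum_def A_prod_def direct_sum_def)
  ultimately show "(\<lambda>p\<in>primes. ppow_mod_red R p n (x p)) \<in> A_sum R n"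
    unfolding A_sum_def A_prod_def direct_sum_def by blast
qed

lemma A_system: "inverse_system (A_ring R) (A_red R)"
proof (intro inverse_system.intro A_ring_cring)
  show "A_red R n \<in> ring_hom (A_ring R (Suc n)) (A_ring R n)" for n
    unfolding A_red_def A_ring_def
    by (intro induced_map_hom A_sum_ideal A_prod_red_hom A_prod_red_sum)
qed

lemma A_hat_cring: "cring (A_hat R)"
  unfolding A_hat_def by (rule inverse_system.proj_lim_cring[OF A_system])

section \<open>Families of p-adic elements and the natural surjection\<close>

abbreviation "padic_prod \<equiv> prod_ring primes (padic_ring R)"

lemma padic_prod_cring: "cring padic_prod"
  by (rule prod_ring_cring) (rule padic_cring)

lemma padic_prod_proj: "prime p \<Longrightarrow> ring_hom_cring padic_prod (padic_ring R p) (\<lambda>x. x p)"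
  by (intro ring_hom_cring_of_hom padic_prod_cring padic_cring prod_ring_proj_hom) auto

lemma padic_prod_level_hom:
  assumes "n \<ge> 1"
  shows "(\<lambda>x. \<lambda>p\<in>primes. x p n) \<in> ring_hom padic_prod (A_prod R n)"
  unfolding A_prod_def
  using padic_proj[OF assms] by (intro prod_ring_map_hom) (simp add: ring_hom_cring_def ring_hom_cring_axioms_def)

lemma A_hat_pi_hom: "A_hat_pi R \<in> ring_hom padic_prod (A_hat R)"
  unfolding A_hat_def
proof (rule inverse_system.proj_lim_homI[OF A_system])
  fix n :: nat assume n: "n \<ge> 1"
  have "(\<lambda>x. A_hat_pi R x n) = (+>\<^bsub>A_prod R n\<^esub>) (A_sum R n) \<circ> (\<lambda>x. \<lambda>p\<in>primes. x p n)"
    using n by (auto simp: A_hat_pi_def)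
  then show "(\<lambda>x. A_hat_pi R x n) \<in> ring_hom padic_prod (A_ring R n)"
    using ring_hom_trans[OF padic_prod_level_hom[OF n] ideal.rcos_ring_hom[OF A_sum_ideal]]
    by (simp add: A_ring_def)
  fix x assume x: "x \<in> carrier padic_prod"
  have "ppow_mod_red R p n (x p (Suc n)) = x p n" if "prime p" for p
    using prod_ring_mem[OF x, of p] that n
    by (simp add: padic_ring_def inverse_system.proj_lim_carrier[OF padic_system])
  then have "(\<lambda>p\<in>primes. ppow_mod_red R p n ((\<lambda>p\<in>primes. x p (Suc n)) p)) = (\<lambda>p\<in>primes. x p n)"
    by (intro restrict_ext) auto
  moreover have "(\<lambda>p\<in>primes. x p (Suc n)) \<in> carrier (A_prod R (Suc n))"
    using x by (intro ring_hom_closed[OF padic_prod_level_hom]) auto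
  ultimately show "A_red R n (A_hat_pi R x (Suc n)) = A_hat_pi R x n"
    using n by (simp add: A_hat_pi_def A_red_def
        induced_map_coset[OF A_sum_ideal A_sum_ideal A_prod_red_hom A_prod_red_sum])
qed (auto simp: A_hat_pi_def padic_prod_cring)

lemma A_hat_pi_hom_cring: "ring_hom_cring padic_prod (A_hat R) (A_hat_pi R)"
  by (intro ring_hom_cring_of_hom padic_prod_cring A_hat_cring A_hat_pi_hom)

text \<open>The difference of the two families at level \<open>n\<close> has finite support, so it
  lies in the direct sum that is divided out.\<close>

lemma A_hat_pi_level_cong:
  assumes "x \<in> carrier padic_prod" "y \<in> carrier padic_prod" "n \<ge> 1"
    and "finite {p \<in> primes. x p n \<noteq> y p n}"
  shows "A_hat_pi R x n = A_hat_pi R y n"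
proof -
  interpret A: cring "A_prod R n" by (rule A_prod_cring)
  interpret I: ideal "A_sum R n" "A_prod R n" by (rule A_sum_ideal)
  interpret L: ring_hom_cring padic_prod "A_prod R n" "\<lambda>x. \<lambda>p\<in>primes. x p n"
    by (intro ring_hom_cring_of_hom padic_prod_cring A_prod_cring padic_prod_level_hom assms)
  define u v where "u = (\<lambda>p\<in>primes. x p n)" and "v = (\<lambda>p\<in>primes. y p n)"
  have u: "u \<in> carrier (A_prod R n)" and v: "v \<in> carrier (A_prod R n)"
    using L.hom_closed assms by (simp_all add: u_def v_def)
  have "(u \<ominus>\<^bsub>A_prod R n\<^esub> v) p = \<zero>\<^bsub>ppow_mod R p n\<^esub>" if "prime p" "x p n = y p n" for p
  proof -
    interpret ring_hom_cring "A_prod R n" "ppow_mod R p n" "\<lambda>x. x p"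
      using that unfolding A_prod_def
      by (intro ring_hom_cring_of_hom prod_ring_cring ppow_mod_cring prod_ring_proj_hom) auto
    have "u p = v p" "v p \<in> carrier (ppow_mod R p n)"
      using that hom_closed[OF v] by (simp_all add: u_def v_def)
    then show ?thesis using u v by (simp add: A.minus_eq S.r_neg)
  qed
  then have "finite {p \<in> primes. (u \<ominus>\<^bsub>A_prod R n\<^esub> v) p \<noteq> \<zero>\<^bsub>ppow_mod R p n\<^esub>}"
    by (intro finite_subset[OF _ assms(4)]) auto
  then have "u \<ominus>\<^bsub>A_prod R n\<^esub> v \<in> A_sum R n"
    using A.minus_closed[OF u v] by (simp add: A_sum_def A_prod_def direct_sum_def)
  then have "A_sum R n +>\<^bsub>A_prod R n\<^esub> u = A_sum R n +>\<^bsub>A_prod R n\<^esub> v"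
    using u v I.a_rcos_module_minus[OF A.ring_axioms v u] I.a_repr_independence'[of u v] by simp
  then show ?thesis using assms(3) by (simp add: A_hat_pi_def u_def v_def)
qed

lemma A_hat_pi_eqI:
  assumes "x \<in> carrier padic_prod" "y \<in> carrier padic_prod"
    and "\<And>n. n \<ge> 1 \<Longrightarrow> finite {p \<in> primes. x p n \<noteq> y p n}"
  shows "A_hat_pi R x = A_hat_pi R y"
proof
  fix n
  show "A_hat_pi R x n = A_hat_pi R y n"
    using A_hat_pi_level_cong[OF assms(1,2) _ assms(3)]
    by (cases "n \<ge> 1") (auto simp: A_hat_pi_def)
qed

text \<open>In a product of discrete spaces convergence means that every coordinate is eventually
  constant. So it suffices that at each level the partial sums agree with \<open>V\<close> from some
  point on, up to finitely many primes, which may vary with \<open>N\<close>.\<close>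

lemma A_hat_suminf_pi:
  assumes B: "\<And>i. B i \<in> carrier padic_prod" and V: "V \<in> carrier padic_prod"
    and conv: "\<And>n. n \<ge> 1 \<Longrightarrow> \<exists>m. \<forall>N\<ge>m. finite {p \<in> primes. (\<Oplus>\<^bsub>padic_prod\<^esub>i\<in>{..<N}. B i) p n \<noteq> V p n}"
  shows "A_hat_suminf R (\<lambda>i. A_hat_pi R (B i)) = A_hat_pi R V"
proof -
  interpret ring_hom_cring padic_prod "A_hat R" "A_hat_pi R" by (rule A_hat_pi_hom_cring)
  let ?T = "product_topology (\<lambda>n. discrete_topology (carrier (A_ring R n))) {1..}"
  define S where "S N = (\<Oplus>\<^bsub>A_hat R\<^esub>i\<in>{..<N}. A_hat_pi R (B i))" for N
  have S: "S N = A_hat_pi R (\<Oplus>\<^bsub>padic_prod\<^esub>i\<in>{..<N}. B i)" for N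
    using B by (simp add: S_def o_def)
  have S_closed: "S N \<in> carrier (A_hat R)" for N
    using B by (simp add: S)
  have topspace: "carrier (A_hat R) \<subseteq> topspace ?T"
  proof
    fix x assume "x \<in> carrier (A_hat R)"
    then have "x \<in> carrier (prod_ring {1..} (A_ring R))"
      by (simp add: A_hat_def inverse_system.proj_lim_carrier[OF A_system])
    then show "x \<in> topspace ?T" by (simp add: prod_ring_def del: One_nat_def)
  qed
  have lim: "limitin (A_hat_topology R) S (A_hat_pi R V) sequentially"
    unfolding A_hat_topology_def limitin_subtopology limitin_componentwise
  proof (intro conjI ballI)
    show "A_hat_pi R V \<in> extensional {1..}" by (simp add: A_hat_pi_def)
    show "\<forall>\<^sub>F N in sequentially. S N \<in> topspace ?T" 
      by (rule always_eventually) (use S_closed topspace in blast)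
    fix n :: nat assume "n \<in> {1..}"
    then have n: "n \<ge> 1" by simp
    from conv[OF n] obtain m where m: "\<And>N. N \<ge> m \<Longrightarrow>
      finite {p \<in> primes. (\<Oplus>\<^bsub>padic_prod\<^esub>i\<in>{..<N}. B i) p n \<noteq> V p n}" by blast
    have "\<forall>\<^sub>F N in sequentially. S N n = A_hat_pi R V n"
      using eventually_ge_at_top[of m]
    proof eventually_elim
      case (elim N)
      then show ?case
        unfolding S using m n B V by (intro A_hat_pi_level_cong) (auto intro!: finsum_closed)
    qed
    moreover have "A_hat_pi R V n \<in> carrier (A_ring R n)"
      using topspace hom_closed[OF V] n by fastforce
    ultimately show "limitin (discrete_topology (carrier (A_ring R n))) (\<lambda>N. S N n) (A_hat_pi R V n) sequentially"
      by (auto simp: limitin_def elim: eventually_mono)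
  qed (use S_closed hom_closed[OF V] in \<open>auto intro: always_eventually\<close>)
  \<comment> \<open>Uniqueness of limits, for the definite description in
    \<open>A_hat_suminf\<close>.\<close>
  have "Hausdorff_space (A_hat_topology R)"
    unfolding A_hat_topology_def
    by (intro Hausdorff_space_subtopology) (simp add: Hausdorff_space_product_topology)
  then have "(THE L. limitin (A_hat_topology R) S L sequentially) = A_hat_pi R V"
    using lim by (intro the_equality limitin_Hausdorff_unique[of "A_hat_topology R" S _ sequentially]) simp_all
  then show ?thesis by (simp add: A_hat_suminf_def S_def[abs_def])
qed

end

section \<open>Polynomials with \<open>p\<close>-integral coefficients\<close>

lemma Zt_simps:
  "x \<otimes>\<^bsub>Zt r\<^esub> y = x * y" "x \<oplus>\<^bsub>Zt r\<^esub> y = x + y" "\<one>\<^bsub>Zt r\<^esub> = 1" "\<zero>\<^bsub>Zt r\<^esub> = 0"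
  by (simp_all add: Zt_def)

lemma Zt_closed:
  "0 \<in> carrier (Zt r)" "1 \<in> carrier (Zt r)"
  "x \<in> carrier (Zt r) \<Longrightarrow> - x \<in> carrier (Zt r)"
  "\<lbrakk>x \<in> carrier (Zt r); y \<in> carrier (Zt r)\<rbrakk> \<Longrightarrow> x + y \<in> carrier (Zt r)"
  "\<lbrakk>x \<in> carrier (Zt r); y \<in> carrier (Zt r)\<rbrakk> \<Longrightarrow> x * y \<in> carrier (Zt r)"
proof -
  show "x + y \<in> carrier (Zt r)" if "x \<in> carrier (Zt r)" "y \<in> carrier (Zt r)"
    using that Poly_Mapping.keys_add[of x y] by (fastforce simp: Zt_def)
  show "x * y \<in> carrier (Zt r)" if "x \<in> carrier (Zt r)" "y \<in> carrier (Zt r)"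
    unfolding Zt_def
  proof (clarsimp)
    fix m i assume "m \<in> Poly_Mapping.keys (x * y)" "i \<in> Poly_Mapping.keys m"
    moreover from this obtain a b where "m = a + b" "a \<in> Poly_Mapping.keys x" "b \<in> Poly_Mapping.keys y"
      using keys_mult[of x y] by blast
    moreover from this have "Poly_Mapping.keys m \<subseteq> Poly_Mapping.keys a \<union> Poly_Mapping.keys b" using Poly_Mapping.keys_add[of a b] by simp
    ultimately show "Suc 0 \<le> i \<and> i \<le> r" using that by (fastforce simp: Zt_def)
  qed
qed (auto simp: Zt_def)

lemma Zt_cring: "cring (Zt r)"
proof (rule cringI)
  show "abelian_group (Zt r)"
  proof (rule abelian_groupI)
    show "\<exists>y\<in>carrier (Zt r). y \<oplus>\<^bsub>Zt r\<^esub> x = \<zero>\<^bsub>Zt r\<^esub>" if "x \<in> carrier (Zt r)" for x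
      using that by (intro bexI[of _ "- x"]) (auto simp: Zt_simps Zt_closed)
  qed (auto simp: Zt_simps Zt_closed algebra_simps)
  show "Group.comm_monoid (Zt r)"
    by (rule comm_monoidI) (auto simp: Zt_simps Zt_closed algebra_simps)
qed (auto simp: Zt_simps algebra_simps)

lemma Zt_coefficient_ring: "coefficient_ring (Zt r)"
  by (rule coefficient_ring.intro) (rule Zt_cring)

lemma Zt_add_pow: "[(n::nat)] \<cdot>\<^bsub>Zt r\<^esub> x = of_nat n * x"
proof -
  interpret cring "Zt r" by (rule Zt_cring)
  show ?thesis by (induction n) (simp_all add: Zt_simps algebra_simps)
qed

lemma Zt_of_nat: "of_nat n \<in> carrier (Zt r)"
  by (induction n) (auto intro: Zt_closed)

lemma indet_in_Zt: "i \<in> {1..r} \<Longrightarrow> indet i \<in> carrier (Zt r)"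
  by (auto simp: Zt_def indet_def)

locale localization =
  fixes r p :: nat
  assumes prime: "prime p"
begin

sublocale coefficient_ring "Zt r" by (rule Zt_coefficient_ring)
sublocale S: cring "padic_ring (Zt r) p" by (rule padic_cring)

abbreviation S where "S \<equiv> padic_ring (Zt r) p"
abbreviation \<phi> where "\<phi> \<equiv> to_padic (Zt r) p"
abbreviation nS :: "nat \<Rightarrow> nat \<Rightarrow> zpoly set" where "nS d \<equiv> [d] \<cdot>\<^bsub>S\<^esub> \<one>\<^bsub>S\<^esub>"

text \<open>The graph of the ring homomorphism from \<open>\<int>\<^bsub>(p)\<^esub>[t\<^sub>1, \<dots>, t\<^sub>r]\<close> to the
  \<open>p\<close>-adic completion.\<close>

definition rep :: "zpoly fract \<Rightarrow> (nat \<Rightarrow> zpoly set) \<Rightarrow> bool" where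
  "rep x y \<longleftrightarrow> y \<in> carrier S \<and> (\<exists>a\<in>carrier (Zt r). \<exists>d. coprime d p \<and>
     of_nat d * x = Fract a 1 \<and> nS d \<otimes>\<^bsub>S\<^esub> y = \<phi> a)"

lemma coprime_nonzero: "coprime d p \<Longrightarrow> d \<noteq> 0"
  using prime by (metis coprime_0_left_iff not_prime_unit)

lemma nS_Units: "coprime d p \<Longrightarrow> nS d \<in> Units S"
  using padic_Units coprime_nonzero by simp

lemma rep_closed: "rep x y \<Longrightarrow> y \<in> carrier S"
  by (simp add: rep_def)

lemma phi_hom:
  "a \<in> carrier (Zt r) \<Longrightarrow> \<phi> a \<in> carrier S"
  "\<lbrakk>a \<in> carrier (Zt r); b \<in> carrier (Zt r)\<rbrakk> \<Longrightarrow> \<phi> (a * b) = \<phi> a \<otimes>\<^bsub>S\<^esub> \<phi> b"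
  "\<lbrakk>a \<in> carrier (Zt r); b \<in> carrier (Zt r)\<rbrakk> \<Longrightarrow> \<phi> (a + b) = \<phi> a \<oplus>\<^bsub>S\<^esub> \<phi> b"
  "\<phi> 1 = \<one>\<^bsub>S\<^esub>"
  "a \<in> carrier (Zt r) \<Longrightarrow> \<phi> (- a) = \<ominus>\<^bsub>S\<^esub> \<phi> a"
  "\<phi> (of_nat n) = nS n"
proof -
  interpret h: ring_hom_cring "Zt r" S \<phi> by (rule to_padic_hom_cring)
  show "\<phi> a \<in> carrier S" if "a \<in> carrier (Zt r)" using that by simp
  show "\<phi> (a * b) = \<phi> a \<otimes>\<^bsub>S\<^esub> \<phi> b" if "a \<in> carrier (Zt r)" "b \<in> carrier (Zt r)"
    using h.hom_mult[OF that] by (simp add: Zt_simps)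
  show *: "\<phi> (a + b) = \<phi> a \<oplus>\<^bsub>S\<^esub> \<phi> b" if "a \<in> carrier (Zt r)" "b \<in> carrier (Zt r)" for a b
    using h.hom_add[OF that] by (simp add: Zt_simps)
  show "\<phi> 1 = \<one>\<^bsub>S\<^esub>" using h.hom_one by (simp add: Zt_simps)
  show "\<phi> (- a) = \<ominus>\<^bsub>S\<^esub> \<phi> a" if a: "a \<in> carrier (Zt r)"
  proof -
    have "\<phi> (- a) \<oplus>\<^bsub>S\<^esub> \<phi> a = \<zero>\<^bsub>S\<^esub>"
      using *[of "- a" a] h.hom_zero a by (simp add: Zt_simps Zt_closed)
    then show ?thesis using a h.hom_closed Zt_closed(3) by (intro S.minus_equality[symmetric]) auto
  qed
  show "\<phi> (of_nat n) = nS n"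
    using h.ring.hom_add_pow[of 1 n] h.hom_one by (simp add: Zt_add_pow Zt_simps Zt_closed)
qed

text \<open>Clearing both denominators gives an equation between polynomials, and integers prime to
  \<open>p\<close> are units of \<open>S\<close>. Hence an equation between fractions can be read in
  the completion, whatever denominators were used.\<close>

lemma rep_unique:
  assumes "rep x y" "rep x y'"
  shows "y = y'"
proof -
  from assms obtain a d a' d' where
    a: "a \<in> carrier (Zt r)" "coprime d p" "of_nat d * x = Fract a 1" "nS d \<otimes>\<^bsub>S\<^esub> y = \<phi> a" and
    a': "a' \<in> carrier (Zt r)" "coprime d' p" "of_nat d' * x = Fract a' 1" "nS d' \<otimes>\<^bsub>S\<^esub> y' = \<phi> a'"
    by (auto simp: rep_def)
  have "of_nat d' * (of_nat d * x) = of_nat d * (of_nat d' * x)"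
    by (rule mult.left_commute)
  then have "Fract (of_nat d' * a) 1 = Fract (of_nat d * a') 1"
    unfolding a a' by (simp add: of_nat_fract)
  then have eq: "of_nat d' * a = of_nat d * a'" by (simp add: eq_fract)
  have "nS d' \<otimes>\<^bsub>S\<^esub> (nS d \<otimes>\<^bsub>S\<^esub> y) = \<phi> (of_nat d' * a)"
    using a by (simp add: phi_hom Zt_of_nat)
  also have "\<dots> = nS d \<otimes>\<^bsub>S\<^esub> (nS d' \<otimes>\<^bsub>S\<^esub> y')"
    using a' by (simp add: eq phi_hom Zt_of_nat)
  also have "\<dots> = nS d' \<otimes>\<^bsub>S\<^esub> (nS d \<otimes>\<^bsub>S\<^esub> y')"
    using assms by (simp add: S.m_lcomm rep_closed)
  finally show ?thesis
    using assms a(2) a'(2) by (simp add: nS_Units rep_closed)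
qed

lemma rep_poly: "a \<in> carrier (Zt r) \<Longrightarrow> rep (Fract a 1) (\<phi> a)"
  by (auto simp: rep_def phi_hom intro!: bexI[of _ a] exI[of _ 1])

lemma rep_of_nat: "rep (of_nat n) (nS n)"
  using rep_poly[of "of_nat n"] by (simp add: phi_hom Zt_of_nat of_nat_fract)

lemma rep_0: "rep 0 \<zero>\<^bsub>S\<^esub>" and rep_1: "rep 1 \<one>\<^bsub>S\<^esub>"
  using rep_of_nat[of 0] rep_of_nat[of 1] by simp_all

lemma rep_add:
  assumes "rep x y" "rep x' y'"
  shows "rep (x + x') (y \<oplus>\<^bsub>S\<^esub> y')"
proof -
  from assms obtain a d a' d' where
    a: "a \<in> carrier (Zt r)" "coprime d p" "of_nat d * x = Fract a 1" "nS d \<otimes>\<^bsub>S\<^esub> y = \<phi> a" and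
    a': "a' \<in> carrier (Zt r)" "coprime d' p" "of_nat d' * x' = Fract a' 1" "nS d' \<otimes>\<^bsub>S\<^esub> y' = \<phi> a'"
    by (auto simp: rep_def)
  note y = rep_closed[OF assms(1)] rep_closed[OF assms(2)]
  have "of_nat (d * d') * (x + x') = of_nat d' * (of_nat d * x) + of_nat d * (of_nat d' * x')"
    by (simp add: algebra_simps)
  also have "\<dots> = Fract (of_nat d' * a + of_nat d * a') 1"
    unfolding a a' by (simp add: of_nat_fract)
  finally have 1: "of_nat (d * d') * (x + x') = Fract (of_nat d' * a + of_nat d * a') 1" .
  have "nS (d * d') \<otimes>\<^bsub>S\<^esub> (y \<oplus>\<^bsub>S\<^esub> y') = nS d' \<otimes>\<^bsub>S\<^esub> (nS d \<otimes>\<^bsub>S\<^esub> y) \<oplus>\<^bsub>S\<^esub> nS d \<otimes>\<^bsub>S\<^esub> (nS d' \<otimes>\<^bsub>S\<^esub> y')"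
    using y by (simp add: S.m_ac S.l_distr S.r_distr flip: S.add_pow_one_mult)
  also have "\<dots> = \<phi> (of_nat d' * a + of_nat d * a')"
    using a a' by (simp add: phi_hom Zt_of_nat Zt_closed)
  finally show ?thesis
    unfolding rep_def using 1 a a' y
    by (intro conjI bexI[of _ "of_nat d' * a + of_nat d * a'"] exI[of _ "d * d'"]) (auto intro!: Zt_closed Zt_of_nat)
qed

lemma rep_mult:
  assumes "rep x y" "rep x' y'"
  shows "rep (x * x') (y \<otimes>\<^bsub>S\<^esub> y')"
proof -
  from assms obtain a d a' d' where
    a: "a \<in> carrier (Zt r)" "coprime d p" "of_nat d * x = Fract a 1" "nS d \<otimes>\<^bsub>S\<^esub> y = \<phi> a" and
    a': "a' \<in> carrier (Zt r)" "coprime d' p" "of_nat d' * x' = Fract a' 1" "nS d' \<otimes>\<^bsub>S\<^esub> y' = \<phi> a'"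
    by (auto simp: rep_def)
  note y = rep_closed[OF assms(1)] rep_closed[OF assms(2)]
  have "of_nat (d * d') * (x * x') = (of_nat d * x) * (of_nat d' * x')"
    by (simp add: algebra_simps)
  also have "\<dots> = Fract (a * a') 1"
    unfolding a a' by simp
  finally have 1: "of_nat (d * d') * (x * x') = Fract (a * a') 1" .
  have "nS (d * d') \<otimes>\<^bsub>S\<^esub> (y \<otimes>\<^bsub>S\<^esub> y') = (nS d \<otimes>\<^bsub>S\<^esub> y) \<otimes>\<^bsub>S\<^esub> (nS d' \<otimes>\<^bsub>S\<^esub> y')"
    using y by (simp add: S.m_ac flip: S.add_pow_one_mult)
  also have "\<dots> = \<phi> (a * a')"
    using a a' by (simp add: phi_hom)
  finally show ?thesis
    unfolding rep_def using 1 a a' y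
    by (intro conjI bexI[of _ "a * a'"] exI[of _ "d * d'"]) (auto intro!: Zt_closed)
qed

lemma rep_uminus: 
  assumes "rep x y"
  shows "rep (- x) (\<ominus>\<^bsub>S\<^esub> y)"
proof -
  have "rep (Fract (- 1) 1 * x) (\<phi> (- 1) \<otimes>\<^bsub>S\<^esub> y)"
    by (intro rep_mult rep_poly assms Zt_closed)
  moreover have "\<phi> (- 1) \<otimes>\<^bsub>S\<^esub> y = \<ominus>\<^bsub>S\<^esub> y"
    using rep_closed[OF assms] by (simp add: phi_hom Zt_closed S.l_minus)
  moreover have "Fract (- 1) 1 * x = - x"
    by (simp add: One_fract_def[symmetric] flip: minus_fract)
  ultimately show ?thesis by simp
qed

lemma rep_minus: "\<lbrakk>rep x y; rep x' y'\<rbrakk> \<Longrightarrow> rep (x - x') (y \<ominus>\<^bsub>S\<^esub> y')"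
  using rep_add[OF _ rep_uminus] by (simp add: S.minus_eq)

lemma rep_divide:
  assumes "rep x y" "coprime n p"
  shows "rep (x / of_nat n) (y \<otimes>\<^bsub>S\<^esub> inv\<^bsub>S\<^esub> nS n)"
proof -
  have n: "nS n \<in> Units S" "n \<noteq> 0" using nS_Units coprime_nonzero assms by auto
  then have "rep (1 / of_nat n) (inv\<^bsub>S\<^esub> nS n)"
    unfolding rep_def using assms(2)
    by (intro conjI bexI[of _ 1] exI[of _ n]) (auto simp: One_fract_def[symmetric] phi_hom Zt_closed)
  from rep_mult[OF assms(1) this] show ?thesis by simp
qed

lemma rep_power: "rep x y \<Longrightarrow> rep (x ^ n) (y [^]\<^bsub>S\<^esub> n)"
proof (induction n)
  case (Suc n)
  then show ?case using rep_mult[OF Suc.prems Suc.IH[OF Suc.prems]] rep_closed[OF Suc.prems]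
    by (simp add: S.m_comm)
qed (simp add: rep_1)

lemma rep_sum:
  assumes "\<And>i. i \<in> A \<Longrightarrow> rep (f i) (g i)"
  shows "rep (sum f A) (finsum S g A)"
  using assms
proof (induction A rule: infinite_finite_induct)
  case (insert i A)
  have "g \<in> A \<rightarrow> carrier S" "g i \<in> carrier S" using insert.prems rep_closed by blast+
  then show ?case using insert rep_add[of "f i" "g i"] by (simp add: S.finsum_insert)
qed (simp_all add: rep_0)

lemma rep_prod:
  assumes "\<And>i. i \<in> A \<Longrightarrow> rep (f i) (g i)"
  shows "rep (prod f A) (finprod S g A)"
  using assms
proof (induction A rule: infinite_finite_induct)
  case (insert i A)
  have "g \<in> A \<rightarrow> carrier S" "g i \<in> carrier S" using insert.prems rep_closed by blast+
  then show ?case using insert rep_mult[of "f i" "g i"] by (simp add: S.finprod_insert)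
qed (simp_all add: rep_1)

text \<open>With the domain of \<open>rep\<close> as \<open>L\<close>, every remainder produced by
  the estimates over the field has an image in the completion.\<close>

sublocale local_subring p "{x. \<exists>y. rep x y}"
proof
  show "prime p" by (rule prime)
qed (auto intro: rep_1 rep_add rep_uminus rep_mult rep_divide)

text \<open>The summation variables stay below \<open>p\<close>, so all denominators are prime to
  \<open>p\<close> and the sums in the field and in the completion correspond term by term.\<close>

lemma rep_li_star:
  assumes "length ks = length as" "set as \<subseteq> carrier (Zt r)"
  shows "rep (li_star (p - 1) ks (map (\<lambda>a. Fract a 1) as)) (li_sh_star S (p - 1) ks (map \<phi> as))"
  unfolding li_star_def li_sh_star_def li_term_def
proof (intro rep_sum rep_prod rep_divide)
  fix ns j assume "ns \<in> star_tuples (p - 1) (length ks)" and j: "j \<in> {..<length ks}"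
  then have "ns ! j \<in> {1..p - 1}" by (force simp: star_tuples_def)
  then show "coprime (ns ! j ^ ks ! j) p"
    using prime_gt_0_nat[OF prime] by (auto intro: coprime)
  from j assms show "rep (map (\<lambda>a. Fract a 1) as ! j ^ ((ns @ [0]) ! j - (ns @ [0]) ! Suc j))
      (map \<phi> as ! j [^]\<^bsub>S\<^esub> ((ns @ [0]) ! j - (ns @ [0]) ! Suc j))"
    by (auto intro!: rep_power rep_poly)
qed

end

section \<open>Duality in the completed ring\<close>

abbreviation to_fract :: "zpoly list \<Rightarrow> zpoly fract list" where
  "to_fract \<equiv> map (\<lambda>a. Fract a 1)"

text \<open>The closed form of the \<open>p\<close>-component of \<open>L_star_A\<close> for odd
  \<open>p\<close>.\<close>

definition duality_val :: "nat \<Rightarrow> nat list \<Rightarrow> zpoly list \<Rightarrow> zpoly fract" where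
  "duality_val p ks as = dual_val p (arg_word ks (to_fract as))
     - dual_val p (arg_word ks (to_fract (butlast as @ [1]))) / 2"

lemma to_fract_replicate_1: "to_fract (replicate i 1 @ as) = replicate i 1 @ to_fract as"
  by (simp add: One_fract_def)

lemma butlast_snoc_1:
  assumes "length ks = length as" "ks \<noteq> []" "set as \<subseteq> carrier (Zt r)"
  shows "set (butlast as @ [1]) \<subseteq> carrier (Zt r)" "length ks = length (butlast as @ [1])"
  using assms Zt_closed(2) by (cases as rule: rev_cases; force)+

lemma replicate_1_append_mem:
  "set as \<subseteq> carrier (Zt r) \<Longrightarrow> set (replicate i 1 @ as) \<subseteq> carrier (Zt r)"
  using Zt_closed(2) by (auto simp: set_replicate_conv_if)

context localization
begin

lemma li_star_mem:
  assumes "length ks = length as" "set as \<subseteq> carrier (Zt r)"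
  shows "li_star (p - 1) ks (to_fract as) \<in> {x. \<exists>y. rep x y}"
  using rep_li_star[OF assms] by blast

lemma to_fract_mem: "set as \<subseteq> carrier (Zt r) \<Longrightarrow> set (to_fract as) \<subseteq> {x. \<exists>y. rep x y}"
  by (auto intro!: rep_poly)

text \<open>Both parts of \<open>dual_val\<close> divide by \<open>p\<close>, so integrality is not
  visible from the formula. It follows from \<open>sum_li_star\<close> with \<open>n = 1\<close>,
  which exhibits the value as \<open>li_star\<close> minus a multiple of \<open>p\<close>.\<close>

lemma dual_val_mem:
  assumes "odd p" "length ks = length as" "\<forall>k\<in>set ks. k \<ge> 1" "ks \<noteq> []" "set as \<subseteq> carrier (Zt r)"
  shows "dual_val p (arg_word ks (to_fract as)) \<in> {x. \<exists>y. rep x y}"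
proof -
  have "\<exists>z\<in>{x. \<exists>y. rep x y}.
      (\<Sum>i<1. li_star (p - 1) (replicate i 1 @ ks) (replicate i 1 @ to_fract as) * of_nat p ^ i) =
      dual_val p (arg_word ks (to_fract as)) + of_nat p ^ 1 * z"
    by (rule sum_li_star[OF assms(1) _ _ assms(3,4) to_fract_mem[OF assms(5)]]) (use assms(2) in simp_all)
  then obtain z where z: "z \<in> {x. \<exists>y. rep x y}"
    and eq: "(\<Sum>i<1. li_star (p - 1) (replicate i 1 @ ks) (replicate i 1 @ to_fract as) * of_nat p ^ i) =
      dual_val p (arg_word ks (to_fract as)) + of_nat p ^ 1 * z" by blast
  have "li_star (p - 1) ks (to_fract as) - of_nat p * z = dual_val p (arg_word ks (to_fract as))"
    using eq by simp
  moreover have "li_star (p - 1) ks (to_fract as) - of_nat p * z \<in> {x. \<exists>y. rep x y}"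
    by (intro diff mult of_nat z li_star_mem[OF assms(2,5)])
  ultimately show ?thesis by (simp only:)
qed

lemma duality_val_mem:
  assumes "odd p" "length ks = length as" "\<forall>k\<in>set ks. k \<ge> 1" "ks \<noteq> []" "set as \<subseteq> carrier (Zt r)"
  shows "duality_val p ks as \<in> {x. \<exists>y. rep x y}"
proof -
  note butlast_snoc_1[OF assms(2,4,5)]
  then have "dual_val p (arg_word ks (to_fract (butlast as @ [1]))) / of_nat 2 \<in> {x. \<exists>y. rep x y}"
    using assms by (intro divide dual_val_mem) auto
  then show ?thesis
    unfolding duality_val_def using diff[OF dual_val_mem[OF assms]] by simp
qed

text \<open>At level \<open>n\<close> the partial sums are constant from \<open>N = n\<close> on,
  because the remainder is a multiple of \<open>p^N\<close>. The sum is evaluated in the field,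
  where the closed form is available, and brought back to the completion.\<close>

lemma padic_partial_sum:
  fixes ks as
  defines "l \<equiv> \<lambda>as i. li_sh_star S (p - 1) (replicate i 1 @ ks) (map \<phi> (replicate i 1 @ as))"
  assumes "odd p" and len: "length ks = length as" and ks: "\<forall>k\<in>set ks. k \<ge> 1" "ks \<noteq> []"
    and as: "set as \<subseteq> carrier (Zt r)" and y: "rep (duality_val p ks as) y" and n: "1 \<le> n" "n \<le> N"
  shows "(\<Oplus>\<^bsub>S\<^esub>i\<in>{..<N}. (l as i \<ominus>\<^bsub>S\<^esub> inv\<^bsub>S\<^esub> nS 2 \<otimes>\<^bsub>S\<^esub> l (butlast as @ [1]) i) \<otimes>\<^bsub>S\<^esub> nS p [^]\<^bsub>S\<^esub> i) n = y n"
proof -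
  define as' where "as' = butlast as @ [1]"
  have as': "set as' \<subseteq> carrier (Zt r)" "length ks = length as'"
    unfolding as'_def by (rule butlast_snoc_1[OF len ks(2) as])+
  define x where "x as i = li_star (p - 1) (replicate i 1 @ ks) (replicate i 1 @ to_fract as)" for as i
  have l: "rep (x bs i) (l bs i)" if "set bs \<subseteq> carrier (Zt r)" "length ks = length bs" for bs i
    unfolding l_def x_def to_fract_replicate_1[symmetric]
    by (rule rep_li_star[OF _ replicate_1_append_mem[OF that(1)]]) (simp add: that(2))
  have half: "rep (1 / of_nat 2) (inv\<^bsub>S\<^esub> nS 2)"
    using rep_divide[OF rep_1, of 2] \<open>odd p\<close> nS_Units[of 2] by simp
  have partial: "rep (\<Sum>i<N. (x as i - 1 / of_nat 2 * x as' i) * of_nat p ^ i)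
    (\<Oplus>\<^bsub>S\<^esub>i\<in>{..<N}. (l as i \<ominus>\<^bsub>S\<^esub> inv\<^bsub>S\<^esub> nS 2 \<otimes>\<^bsub>S\<^esub> l as' i) \<otimes>\<^bsub>S\<^esub> nS p [^]\<^bsub>S\<^esub> i)"
    using as as' len by (intro rep_sum rep_mult rep_minus rep_power half rep_of_nat l)
  have sum: "\<exists>z\<in>{x. \<exists>y. rep x y}. (\<Sum>i<N. x bs i * of_nat p ^ i) =
      dual_val p (arg_word ks (to_fract bs)) + of_nat p ^ N * z"
    if "set bs \<subseteq> carrier (Zt r)" "length ks = length bs" for bs
    unfolding x_def using that n ks \<open>odd p\<close> to_fract_mem[OF that(1)] by (intro sum_li_star) auto
  obtain z where z: "z \<in> {x. \<exists>y. rep x y}"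
    "(\<Sum>i<N. x as i * of_nat p ^ i) = dual_val p (arg_word ks (to_fract as)) + of_nat p ^ N * z"
    using sum[OF as len] by blast
  obtain z' where z': "z' \<in> {x. \<exists>y. rep x y}"
    "(\<Sum>i<N. x as' i * of_nat p ^ i) = dual_val p (arg_word ks (to_fract as')) + of_nat p ^ N * z'"
    using sum[OF as'] by blast
  have "z - 1 / of_nat 2 * z' \<in> {x. \<exists>y. rep x y}"
    using half by (intro diff mult z(1) z'(1)) auto
  then obtain w where w: "rep (z - 1 / of_nat 2 * z') w" by blast
  have "(\<Sum>i<N. (x as i - 1 / of_nat 2 * x as' i) * of_nat p ^ i) =
      (\<Sum>i<N. x as i * of_nat p ^ i) - 1 / 2 * (\<Sum>i<N. x as' i * of_nat p ^ i)"
    by (simp add: sum_subtractf sum_distrib_left left_diff_distrib)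
  also have "\<dots> = duality_val p ks as + of_nat (p ^ N) * (z - 1 / of_nat 2 * z')"
    unfolding z(2) z'(2) duality_val_def as'_def[symmetric] by (simp add: algebra_simps)
  finally have eq: "(\<Sum>i<N. (x as i - 1 / of_nat 2 * x as' i) * of_nat p ^ i) =
    duality_val p ks as + of_nat (p ^ N) * (z - 1 / of_nat 2 * z')" .
  have "rep (duality_val p ks as + of_nat (p ^ N) * (z - 1 / of_nat 2 * z'))
      (y \<oplus>\<^bsub>S\<^esub> nS (p ^ N) \<otimes>\<^bsub>S\<^esub> w)"
    by (intro rep_add rep_mult rep_of_nat y w)
  \<comment> \<open>Two images of the same fraction: one from transferring the sum term by term, the
    other from transferring its closed form with remainder.\<close>
  then have "(\<Oplus>\<^bsub>S\<^esub>i\<in>{..<N}. (l as i \<ominus>\<^bsub>S\<^esub> inv\<^bsub>S\<^esub> nS 2 \<otimes>\<^bsub>S\<^esub> l as' i) \<otimes>\<^bsub>S\<^esub> nS p [^]\<^bsub>S\<^esub> i)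
      = y \<oplus>\<^bsub>S\<^esub> nS (p ^ N) \<otimes>\<^bsub>S\<^esub> w"
    by (rule rep_unique[OF partial[unfolded eq]])
  moreover have "(y \<oplus>\<^bsub>S\<^esub> nS (p ^ N) \<otimes>\<^bsub>S\<^esub> w) n = y n"
  proof -
    interpret h: ring_hom_cring S "ppow_mod (Zt r) p n" "\<lambda>x. x n" by (rule padic_proj[OF n(1)])
    show ?thesis
      using rep_closed[OF y] rep_closed[OF w] padic_ppow_mult_zero[OF n rep_closed[OF w]]
        h.hom_add[of y "nS (p ^ N) \<otimes>\<^bsub>S\<^esub> w"] h.hom_closed[of y] by simp
  qed
  ultimately show ?thesis by (simp add: as'_def)
qed

end

lemma finite_prime_exceptions:
  assumes "\<And>p. \<lbrakk>prime p; odd p\<rbrakk> \<Longrightarrow> P p"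
  shows "finite {p \<in> primes. \<not> P p}"
proof (rule finite_subset)
  show "{p \<in> primes. \<not> P p} \<subseteq> {2}"
    using assms primes_dvd_imp_eq[OF two_is_prime_nat] by blast
qed simp

lemma (in coefficient_ring) A_hat_pi_restrict: "A_hat_pi R (\<lambda>p\<in>primes. x p) = A_hat_pi R x"
  by (simp add: A_hat_pi_def cong: restrict_cong)

text \<open>Every ingredient of the series is an image under \<open>A_hat_pi\<close> of a family
  over the primes. As \<open>A_hat_pi\<close> is a ring homomorphism, the terms become images of the
  \<open>B i\<close>, and the limit can be found prime by prime.\<close>

lemma L_star_A_eq:
  assumes len: "length ks = length as" and ks: "\<forall>k\<in>set ks. k \<ge> 1" "ks \<noteq> []"
    and as: "set as \<subseteq> carrier (Zt r)"
    and V: "V \<in> carrier (prod_ring primes (padic_ring (Zt r)))"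
    and rep: "\<And>p. \<lbrakk>prime p; odd p\<rbrakk> \<Longrightarrow> localization.rep r p (duality_val p ks as) (V p)"
  shows "L_star_A (Zt r) ks as = A_hat_pi (Zt r) V"
proof -
  interpret coefficient_ring "Zt r" by (rule Zt_coefficient_ring)
  let ?P = padic_prod and ?A = "A_hat (Zt r)" and ?S = "padic_ring (Zt r)" and ?pi = "A_hat_pi (Zt r)"
  interpret pi: ring_hom_cring ?P ?A ?pi by (rule A_hat_pi_hom_cring)
  have cr: "cring (?S p)" for p by (rule padic_cring)
  define l where "l as i = (\<lambda>p\<in>primes. li_sh_star (?S p) (p - 1) (replicate i 1 @ ks)
      (map (to_padic (Zt r) p) (replicate i 1 @ as)))" for as i
  \<comment> \<open>\<open>2\<close> has no inverse in the \<open>2\<close>-adic component; the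
    default there keeps \<open>H\<close> inside the product and is forgotten by
    \<open>A_hat_pi\<close>.\<close>
  define H where "H = (\<lambda>p\<in>primes. if odd p then inv\<^bsub>?S p\<^esub> ([(2::nat)] \<cdot>\<^bsub>?S p\<^esub> \<one>\<^bsub>?S p\<^esub>) else \<one>\<^bsub>?S p\<^esub>)"
  define Q where "Q = (\<lambda>p\<in>primes. [p] \<cdot>\<^bsub>?S p\<^esub> \<one>\<^bsub>?S p\<^esub>)"
  define as' where "as' = butlast as @ [1]"
  have as': "set as' \<subseteq> carrier (Zt r)" "length ks = length as'"
    unfolding as'_def by (rule butlast_snoc_1[OF len ks(2) as])+
  have l_closed: "l bs i \<in> carrier ?P" if "set bs \<subseteq> carrier (Zt r)" "length ks = length bs" for bs i
    unfolding l_def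
  proof (rule prod_ring_memI)
    fix p assume "p \<in> primes"
    then interpret localization r p by unfold_locales simp
    show "li_sh_star (?S p) (p - 1) (replicate i 1 @ ks) (map (to_padic (Zt r) p) (replicate i 1 @ bs)) \<in> carrier (?S p)"
      by (rule rep_closed[OF rep_li_star[OF _ replicate_1_append_mem[OF that(1)]]]) (simp add: that(2))
  qed
  have unit: "[(2::nat)] \<cdot>\<^bsub>?S p\<^esub> \<one>\<^bsub>?S p\<^esub> \<in> Units (?S p)" if "odd p" for p
    using that by (intro padic_Units) auto
  have H_closed: "H \<in> carrier ?P"
    unfolding H_def
  proof (rule prod_ring_memI)
    fix p interpret S: cring "?S p" by (rule cr)
    show "(if odd p then inv\<^bsub>?S p\<^esub> ([(2::nat)] \<cdot>\<^bsub>?S p\<^esub> \<one>\<^bsub>?S p\<^esub>) else \<one>\<^bsub>?S p\<^esub>) \<in> carrier (?S p)"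
      by (cases "odd p") (simp_all only: if_True if_False not_False_eq_True S.one_closed S.Units_inv_closed[OF unit])
  qed
  have Q_closed: "Q \<in> carrier ?P"
    unfolding Q_def
  proof (rule prod_ring_memI)
    fix p interpret S: cring "?S p" by (rule cr)
    show "[p] \<cdot>\<^bsub>?S p\<^esub> \<one>\<^bsub>?S p\<^esub> \<in> carrier (?S p)" by simp
  qed
  have li: "li_sh_star_A (Zt r) (replicate i 1 @ ks) (replicate i 1 @ bs) = ?pi (l bs i)" for bs i
    unfolding li_sh_star_A_def l_def A_hat_pi_restrict ..
  have p: "A_hat_p (Zt r) = ?pi Q"
    unfolding A_hat_p_def Q_def A_hat_pi_restrict ..
  have half: "A_hat_half (Zt r) = ?pi H"
  proof -
    \<comment> \<open>\<open>(1 + 1) * H\<close> and \<open>1\<close> agree at all odd primes, so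
      their images coincide and \<open>?pi H\<close> is the inverse that defines
      \<open>A_hat_half\<close>.\<close>
    have "?pi ((\<one>\<^bsub>?P\<^esub> \<oplus>\<^bsub>?P\<^esub> \<one>\<^bsub>?P\<^esub>) \<otimes>\<^bsub>?P\<^esub> H) = ?pi \<one>\<^bsub>?P\<^esub>"
    proof (rule A_hat_pi_eqI)
      fix n :: nat
      have "((\<one>\<^bsub>?P\<^esub> \<oplus>\<^bsub>?P\<^esub> \<one>\<^bsub>?P\<^esub>) \<otimes>\<^bsub>?P\<^esub> H) p = \<one>\<^bsub>?P\<^esub> p" if "prime p" "odd p" for p
      proof -
        interpret S: cring "?S p" by (rule cr)
        have "[(2::nat)] \<cdot>\<^bsub>?S p\<^esub> \<one>\<^bsub>?S p\<^esub> = \<one>\<^bsub>?S p\<^esub> \<oplus>\<^bsub>?S p\<^esub> \<one>\<^bsub>?S p\<^esub>"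
          by (simp add: numeral_2_eq_2)
        then show ?thesis
          using that unit[OF that(2)] by (simp add: prod_ring_apply H_def)
      qed
      then show "finite {p \<in> primes. ((\<one>\<^bsub>?P\<^esub> \<oplus>\<^bsub>?P\<^esub> \<one>\<^bsub>?P\<^esub>) \<otimes>\<^bsub>?P\<^esub> H) p n \<noteq> \<one>\<^bsub>?P\<^esub> p n}"
        by (intro finite_prime_exceptions) metis
    qed (use H_closed in simp_all)
    then show ?thesis
      unfolding A_hat_half_def using H_closed by (intro pi.S.comm_inv_char) simp_all
  qed
  define B where "B i = (l as i \<ominus>\<^bsub>?P\<^esub> H \<otimes>\<^bsub>?P\<^esub> l as' i) \<otimes>\<^bsub>?P\<^esub> Q [^]\<^bsub>?P\<^esub> i" for i
  note closed = l_closed[OF as len] l_closed[OF as'] H_closed Q_closed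
  have B_closed: "B i \<in> carrier ?P" for i
    using closed by (simp add: B_def)
  have "L_star_A (Zt r) ks as = A_hat_suminf (Zt r) (\<lambda>i. ?pi (B i))"
    unfolding L_star_A_def Zt_simps(3) as'_def[symmetric] li p half B_def
    using closed by (simp add: a_minus_def pi.ring.hom_nat_pow)
  also have "\<dots> = ?pi V"
  proof (rule A_hat_suminf_pi[OF B_closed V])
    fix n :: nat assume n: "n \<ge> 1"
    have "(\<Oplus>\<^bsub>?P\<^esub>i\<in>{..<N}. B i) p n = V p n" if N: "n \<le> N" and p: "prime p" "odd p" for N p
    proof -
      interpret localization r p by unfold_locales (rule p)
      interpret h: ring_hom_cring ?P S "\<lambda>x. x p" by (rule padic_prod_proj[OF p(1)])
      have "B i p = (l as i p \<ominus>\<^bsub>S\<^esub> inv\<^bsub>S\<^esub> nS 2 \<otimes>\<^bsub>S\<^esub> l as' i p) \<otimes>\<^bsub>S\<^esub> nS p [^]\<^bsub>S\<^esub> i" for i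
      proof -
        have "B i p = (l as i p \<ominus>\<^bsub>S\<^esub> H p \<otimes>\<^bsub>S\<^esub> l as' i p) \<otimes>\<^bsub>S\<^esub> Q p [^]\<^bsub>S\<^esub> i"
          unfolding B_def using closed
          by (simp add: a_minus_def h.ring.hom_nat_pow)
        then show ?thesis using p by (simp add: H_def Q_def)
      qed
      then have "(\<Oplus>\<^bsub>?P\<^esub>i\<in>{..<N}. B i) p =
        (\<Oplus>\<^bsub>S\<^esub>i\<in>{..<N}. (l as i p \<ominus>\<^bsub>S\<^esub> inv\<^bsub>S\<^esub> nS 2 \<otimes>\<^bsub>S\<^esub> l as' i p) \<otimes>\<^bsub>S\<^esub> nS p [^]\<^bsub>S\<^esub> i)"
        using B_closed by (simp add: o_def)
      then show ?thesis
        using padic_partial_sum[OF p(2) len ks as rep[OF p] n N] p by (simp add: l_def as'_def)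
    qed
    \<comment> \<open>The threshold is the level \<open>n\<close> itself, and the only possible
      exceptional prime is \<open>2\<close>.\<close>
    then show "\<exists>m. \<forall>N\<ge>m. finite {p \<in> primes. (\<Oplus>\<^bsub>?P\<^esub>i\<in>{..<N}. B i) p n \<noteq> V p n}"
      by (intro exI[of _ n] allI impI finite_prime_exceptions)
  qed
  finally show ?thesis .
qed

theorem theorem3p4:
  fixes r :: nat and k :: "nat \<Rightarrow> nat list"
  assumes "r \<ge> 1"
    and "\<And>i. i \<in> {1..r} \<Longrightarrow> is_index (k i)"
  shows
    "L_star_A (Zt r)
       (concat (map k [1..<Suc r]))
       (concat (map (\<lambda>i. replicate (length (k i) - 1) 1 @ [indet i]) [1..<Suc r]))
     = L_star_A (Zt r)
       (concat (map (\<lambda>i. hoffman_dual (k i)) [1..<Suc r]))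
       (concat (map (\<lambda>i. replicate (length (hoffman_dual (k i)) - 1) 1 @ [1 - indet i]) [1..<Suc r]))"
proof -
  define args where "args k t = concat (map (\<lambda>i. replicate (length (k i) - 1) 1 @ [t i]) [1..<Suc r])"
    for k :: "nat \<Rightarrow> nat list" and t :: "nat \<Rightarrow> zpoly"
  define idx where "idx k = concat (map k [1..<Suc r])" for k :: "nat \<Rightarrow> nat list"
  define k' where "k' i = hoffman_dual (k i)" for i
  define t' where "t' i = 1 - indet i" for i
  have k': "is_index (k' i)" for i unfolding k'_def by (rule hoffman_dual)
  have idx: "length (idx \<kappa>) = length (args \<kappa> t)" "\<forall>k\<in>set (idx \<kappa>). k \<ge> 1" "idx \<kappa> \<noteq> []"
    if "\<And>i. i \<in> {1..r} \<Longrightarrow> is_index (\<kappa> i)" for \<kappa> t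
  proof -
    have "length (\<kappa> i) > 0" if "i \<in> {1..r}" for i
      using \<open>\<And>i. i \<in> {1..r} \<Longrightarrow> is_index (\<kappa> i)\<close>[OF that] by (auto simp: is_index_def)
    then show "length (idx \<kappa>) = length (args \<kappa> t)"
      unfolding idx_def args_def length_concat map_map
      by (intro arg_cong[of _ _ sum_list] map_cong) auto
    show "\<forall>k\<in>set (idx \<kappa>). k \<ge> 1" using that by (fastforce simp: idx_def is_index_def)
    have "r \<in> {1..r}" using assms(1) by simp
    from that[OF this] \<open>r \<in> {1..r}\<close> show "idx \<kappa> \<noteq> []" by (auto simp: idx_def is_index_def)
  qed
  have args_mem: "set (args \<kappa> t) \<subseteq> carrier (Zt r)" if "\<And>i. i \<in> {1..r} \<Longrightarrow> t i \<in> carrier (Zt r)" for \<kappa> t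
    using that Zt_closed(2) by (auto simp: args_def split: if_splits)
  have args_last: "args \<kappa> t \<noteq> []" for \<kappa> t
    using assms(1) by (simp add: args_def)
  have t: "indet i \<in> carrier (Zt r)" "t' i \<in> carrier (Zt r)" if "i \<in> {1..r}" for i
  proof -
    show "indet i \<in> carrier (Zt r)" using that by (rule indet_in_Zt)
    then have "1 + - indet i \<in> carrier (Zt r)" by (intro Zt_closed)
    then show "t' i \<in> carrier (Zt r)" by (simp add: t'_def)
  qed
  have k_idx: "length (idx k) = length (args k indet)" "\<forall>k\<in>set (idx k). k \<ge> 1" "idx k \<noteq> []"
    using idx[of k] assms(2) by blast+
  have k_mem: "set (args k indet) \<subseteq> carrier (Zt r)" and k'_mem: "set (args k' t') \<subseteq> carrier (Zt r)"
    by (intro args_mem t; assumption)+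
  \<comment> \<open>Both words split into the blocks of the \<open>r\<close> indices, and each block
    is complemented separately.\<close>
  have word: "arg_word (idx k') (to_fract (args k' t')) = map (\<lambda>x. 1 - x) (arg_word (idx k) (to_fract (args k indet)))"
  proof -
    have *: "to_fract (args \<kappa> t) = concat (map (\<lambda>i. replicate (length (\<kappa> i) - 1) 1 @ [Fract (t i) 1]) [1..<Suc r])"
      for \<kappa> t by (simp add: args_def map_concat o_def One_fract_def)
    have **: "arg_word (idx \<kappa>) (to_fract (args \<kappa> t)) =
      concat (map (\<lambda>i. arg_word (\<kappa> i) (replicate (length (\<kappa> i) - 1) 1 @ [Fract (t i) 1])) [1..<Suc r])"
      if "\<And>i. i \<in> {1..r} \<Longrightarrow> is_index (\<kappa> i)" for \<kappa> t
      unfolding * idx_def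
    proof (rule arg_word_concat)
      fix i assume "i \<in> set [1..<Suc r]"
      then have "\<kappa> i \<noteq> []" using that[of i] by (auto simp: is_index_def)
      then show "length (\<kappa> i) = length (replicate (length (\<kappa> i) - 1) 1 @ [Fract (t i) (1::zpoly)])"
        by (cases "\<kappa> i") simp_all
    qed
    have k_word: "arg_word (idx k) (to_fract (args k indet)) =
      concat (map (\<lambda>i. arg_word (k i) (replicate (length (k i) - 1) 1 @ [Fract (indet i) 1])) [1..<Suc r])"
      by (rule **) (rule assms(2))
    have "arg_word (k' i) (replicate (length (k' i) - 1) 1 @ [Fract (t' i) 1]) =
      map (\<lambda>x. 1 - x) (arg_word (k i) (replicate (length (k i) - 1) 1 @ [Fract (indet i) 1]))"
      if "i \<in> {1..r}" for i
    proof -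
      have "Fract (t' i) 1 = 1 - Fract (indet i) 1" by (simp add: t'_def One_fract_def)
      then show ?thesis unfolding k'_def using arg_word_hoffman_dual[OF assms(2)[OF that]] by simp
    qed
    then show ?thesis
      unfolding k_word **[OF k'] map_concat map_map
      by (intro arg_cong[of _ _ concat] map_cong) auto
  qed
  have duality: "duality_val p (idx k) (args k indet) = duality_val p (idx k') (args k' t')" for p
  proof -
    obtain u where u: "\<And>x. arg_word (idx k) (butlast (to_fract (args k indet)) @ [x]) = u @ [x]"
      "arg_word (idx k) (to_fract (args k indet)) = u @ [last (to_fract (args k indet))]"
      using arg_word_snoc[of "idx k" "to_fract (args k indet)"] k_idx(1) args_last by auto
    obtain u' where u': "\<And>x. arg_word (idx k') (butlast (to_fract (args k' t')) @ [x]) = u' @ [x]"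
      "arg_word (idx k') (to_fract (args k' t')) = u' @ [last (to_fract (args k' t'))]"
      using arg_word_snoc[of "idx k'" "to_fract (args k' t')"] idx(1)[OF k'] args_last by auto
    \<comment> \<open>Equality of the complemented words separates into prefix and last
      letter.\<close>
    have "u' = map (\<lambda>x. 1 - x) u" "last (to_fract (args k' t')) = 1 - last (to_fract (args k indet))"
      using word unfolding u(2) u'(2) by auto
    moreover have "to_fract (butlast as @ [1]) = butlast (to_fract as) @ [1]" for as
      by (simp add: map_butlast One_fract_def)
    ultimately show ?thesis
      unfolding duality_val_def using dual_val_symmetric by (simp add: u u')
  qed
  \<comment> \<open>One family serves both sides: by \<open>duality\<close> it represents the closed
    forms of both at every odd prime. The zero at \<open>2\<close> is a default.\<close>
  define V where "V = (\<lambda>p\<in>primes. if odd p then SOME y. localization.rep r p (duality_val p (idx k) (args k indet)) y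
    else \<zero>\<^bsub>padic_ring (Zt r) p\<^esub>)"
  have V_rep: "localization.rep r p (duality_val p (idx k) (args k indet)) (V p)" if "prime p" "odd p" for p
  proof -
    interpret localization r p by unfold_locales (rule that)
    have "\<exists>y. rep (duality_val p (idx k) (args k indet)) y"
      using duality_val_mem[OF that(2) k_idx k_mem] by blast
    from someI_ex[OF this] show ?thesis using that by (simp add: V_def)
  qed
  have V: "V \<in> carrier (prod_ring primes (padic_ring (Zt r)))"
  proof -
    have "V p \<in> carrier (padic_ring (Zt r) p)" if "prime p" for p
    proof (cases "odd p")
      case True
      interpret localization r p by unfold_locales (rule that)
      show ?thesis using V_rep[OF that True] by (rule rep_closed)
    next
      case False
      interpret localization r p by unfold_locales (rule that)
      show ?thesis using that False by (simp add: V_def)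
    qed
    then have "(\<lambda>p\<in>primes. V p) \<in> carrier (prod_ring primes (padic_ring (Zt r)))"
      by (intro prod_ring_memI) simp
    then show ?thesis by (simp add: V_def cong: restrict_cong)
  qed
  have "L_star_A (Zt r) (idx k) (args k indet) = A_hat_pi (Zt r) V"
    by (rule L_star_A_eq[OF k_idx k_mem V V_rep])
  moreover have "L_star_A (Zt r) (idx k') (args k' t') = A_hat_pi (Zt r) V"
    by (rule L_star_A_eq[OF idx[OF k'] k'_mem V V_rep[unfolded duality]])
  ultimately have "L_star_A (Zt r) (idx k) (args k indet) = L_star_A (Zt r) (idx k') (args k' t')"
    by simp
  then show ?thesis
    unfolding idx_def args_def k'_def[abs_def] t'_def .
qed

end
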